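(* Let $n>1$ and $p\in(0,2)$. For every $\xi=(\xi_1,\dots,\xi_n)\in\Omega$, $$\frac{p}{\pi(n-1)\Gamma((n-1)/p)}\int_0^\infty\gamma_p^n\big(t/\sqrt n\big)\,dt\;\le\;\mathrm{Vol}_{n-1}(B_p\cap\xi^\perp)\;\le\;\frac{p}{\pi(n-1)\Gamma((n-1)/p)}\,\gamma_p^{n-1}(0)\int_0^\infty\gamma_p(t)\,dt=\frac{2^{n-1}\,p\,(\Gamma(1+1/p))^{n-1}}{(n-1)\,\Gamma((n-1)/p)}.$$ The left inequality is an equality if and only if $|\xi_i|=1/\sqrt n$ for every $i$, and the right inequality is an equality if and only if one of the coordinates of $\xi$ is equal to $\pm1$ and the others are equal to zero.
   Context: $\Omega$ is the Euclidean unit sphere in $\mathbb{R}^n$, $\xi^\perp=\{x\in\mathbb{R}^n:(x,\xi)=0\}$, and $B_p=\{x\in\mathbb{R}^n:|x_1|^p+\dots+|x_n|^p\le1\}$ is the unit ball of $\ell_p^n$. The function $\gamma_p$ is the Fourier transform of $z\mapsto\exp(-|z|^p)$ on $\mathbb{R}$: $\gamma_p(t)=\int_{\mathbb{R}}e^{-|z|^p}e^{-izt}\,dz$. Powers such as $\gamma_p^n(s)$ mean $(\gamma_p(s))^n$. *)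

theory Defs
  imports "HOL-Analysis.Analysis"
begin

definition orthonormal_basis_of :: "'a::euclidean_space set \<Rightarrow> 'a set \<Rightarrow> bool" where
  "orthonormal_basis_of S B \<longleftrightarrow>
     B \<subseteq> S \<and> pairwise orthogonal B \<and> (\<forall>b\<in>B. norm b = 1) \<and> span B = S"

lemma orthonormal_basis_of_exists:
  fixes S :: "'a::euclidean_space set"
  assumes "subspace S"
  shows "\<exists>B. orthonormal_basis_of S B"
  using orthonormal_basis_subspace[OF assms] unfolding orthonormal_basis_of_def by metis

lemma orthonormal_basis_of_finite_card:
  fixes S :: "'a::euclidean_space set"
  assumes "orthonormal_basis_of S B"
  shows "finite B" and "card B = dim S"
proof -
  have "independent B"
    using assms unfolding orthonormal_basis_of_def
    by (intro pairwise_orthogonal_independent) auto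
  then show "finite B" "card B = dim S"
    using assms independent_imp_finite dim_span_eq_card_independent
    unfolding orthonormal_basis_of_def by metis+
qed

text \<open>
  Lebesgue (Borel) measure of a linear subspace, of dimension that of the subspace: the image of the
  product of one-dimensional Lebesgue measures under orthonormal coordinates. This is the library's
  construction of \<^const>\<open>lborel\<close>, with an orthonormal basis of the subspace in place of
  \<^const>\<open>Basis\<close>. The choice of the basis is immaterial since Lebesgue measure is invariant under
  orthogonal maps.
\<close>

definition lborel_subspace :: "'a::euclidean_space set \<Rightarrow> 'a measure" where
  "lborel_subspace S =
     (let B = (SOME B. orthonormal_basis_of S B)
      in distr (\<Pi>\<^sub>M b\<in>B. lborel) borel (\<lambda>c. \<Sum>b\<in>B. c b *\<^sub>R b))"

definition orth_hyperplane :: "'a::euclidean_space \<Rightarrow> 'a set" where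
  "orth_hyperplane \<xi> = {x. x \<bullet> \<xi> = 0}"

lemma dim_orth_hyperplane:
  fixes \<xi> :: "'a::euclidean_space"
  assumes "\<xi> \<noteq> 0"
  shows "dim (orth_hyperplane \<xi>) = DIM('a) - 1"
  using dim_hyperplane[OF assms] by (simp add: orth_hyperplane_def inner_commute)

definition lp_ball :: "real \<Rightarrow> (real ^ 'n) set" where
  "lp_ball p = {x. (\<Sum>i\<in>UNIV. \<bar>x $ i\<bar> powr p) \<le> 1}"

definition central_section_volume :: "real \<Rightarrow> real ^ 'n \<Rightarrow> real" where
  "central_section_volume p \<xi> =
     measure (lborel_subspace (orth_hyperplane \<xi>)) (lp_ball p \<inter> orth_hyperplane \<xi>)"

text \<open>
  The Fourier transform of an even real function is real-valued, so taking the real part below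
  loses nothing; see the lemma that follows.
\<close>

definition gamma_p :: "real \<Rightarrow> real \<Rightarrow> real" where
  "gamma_p p t =
     Re (LINT z|lborel. complex_of_real (exp (- (\<bar>z\<bar> powr p))) * exp (- (\<i> * of_real z * of_real t)))"

lemma complex_of_real_gamma_p:
  "complex_of_real (gamma_p p t) =
     (LINT z|lborel. complex_of_real (exp (- (\<bar>z\<bar> powr p))) * exp (- (\<i> * of_real z * of_real t)))"
proof -
  let ?f = "\<lambda>z::real. complex_of_real (exp (- (\<bar>z\<bar> powr p))) * exp (- (\<i> * of_real z * of_real t))"
  have "cnj (LINT z|lborel. ?f z) = (LINT z|lborel. cnj (?f z))"
    by (rule Bochner_Integration.integral_cnj[symmetric])
  also have "\<dots> = (LINT z|lborel. ?f (0 + (-1) * z))"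
    by (intro Bochner_Integration.integral_cong) (simp_all add: exp_cnj)
  also have "\<dots> = (LINT z|lborel. ?f z)"
    by (subst lborel_integral_real_affine[where c = "-1" and t = 0 and f = ?f]) simp_all
  finally have "(LINT z|lborel. ?f z) \<in> \<real>"
    by (simp only: Reals_cnj_iff)
  then show ?thesis
    unfolding gamma_p_def by (rule of_real_Re)
qed

end

theory Submission
  imports Defs "HOL-Probability.Probability" "HOL-Real_Asymp.Real_Asymp"
begin

text \<open>
  The function \<open>exp (- s powr (p / 2))\<close> is a limit of positive combinations of exponentials
  \<open>exp (- u * s)\<close>, so \<open>exp (- \<bar>z\<bar> powr p)\<close> is a limit of Gaussian mixtures and
  \<open>h q = ln (gamma_p p (sqrt q))\<close> is convex. Integrating \<open>exp (- \<bar>x 1\<bar> powr p - \<dots> - \<bar>x n\<bar> powr p)\<close> over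
  the hyperplane in two ways, by layers of \<open>lp_ball p\<close> and by Fourier inversion on the line spanned by
  \<open>\<xi>\<close>, turns the section volume into a multiple of the integral over \<open>t \<ge> 0\<close> of the product of the
  \<open>gamma_p p (t * \<xi> $ i)\<close>, whose logarithm is the sum of the \<open>h (t\<^sup>2 * (\<xi> $ i)\<^sup>2)\<close>. Both bounds are then Jensen's
  inequality for \<open>h\<close>, at the mean of the squared coordinates and on the chord from 0 to \<open>t\<^sup>2\<close>. Equality outside
  the stated cases makes \<open>h\<close> affine, hence \<open>gamma_p p\<close> and \<open>exp (- \<bar>z\<bar> powr p)\<close> Gaussian, which fails for
  \<open>p < 2\<close>.
\<close>

section \<open>Mixtures of Gaussians\<close>

text \<open>The transform of \<open>exp (- a * z\<^sup>2)\<close> at \<open>sqrt q\<close> is a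
  multiple of \<open>exp (- q / (4 * a))\<close>: a Gaussian mixture becomes a mixture of
  exponentials in \<open>q\<close>, and such functions are log-convex. The obstacle to Fourier
  inversion is that no decay of \<open>gamma_p p\<close> is known in advance, so neither it nor the
  product of its dilates is visibly integrable. Nonnegativity replaces decay: Gaussian
  regularization and monotone convergence yield integrability together with the value of the
  integral. The constant has three sources. Inversion makes the integral over the whole line
  \<open>2 * pi\<close> times the integral of \<open>exp (- lp_gauge p x)\<close> over the
  hyperplane; evenness halves it; and with m = n - 1 the layers of the section grow like
  \<open>r powr (m / p)\<close>, so the integral over the hyperplane is
  \<open>Gamma (1 + m / p) = m / p * Gamma (m / p)\<close> times the volume.\<close>

lemma gauss_integrable:
  fixes a :: real
  assumes "a > 0"
  shows "integrable lborel (\<lambda>z::real. exp (- a * z\<^sup>2))"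
    and "(LINT z|lborel. exp (- a * z\<^sup>2)) = sqrt (pi / a)"
proof -
  define \<sigma> where "\<sigma> = 1 / sqrt (2 * a)"
  have \<sigma>: "\<sigma> > 0" and \<sigma>2: "2 * \<sigma>\<^sup>2 = 1 / a"
    using assms by (auto simp: \<sigma>_def power_divide)
  have eq: "exp (- a * z\<^sup>2) = sqrt (pi / a) * normal_density 0 \<sigma> z" for z
  proof -
    have "2 * pi * \<sigma>\<^sup>2 = pi / a"
      using \<sigma>2 by (simp add: field_simps)
    then show ?thesis
      using assms by (simp add: normal_density_def \<sigma>2 mult.commute)
  qed
  show "integrable lborel (\<lambda>z. exp (- a * z\<^sup>2))"
    unfolding eq using \<sigma> by (intro integrable_mult_right integrable_normal_density)
  show "(LINT z|lborel. exp (- a * z\<^sup>2)) = sqrt (pi / a)"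
    unfolding eq using integral_normal_density[OF \<sigma>, of 0] by simp
qed

text \<open>This is the characteristic function of the standard normal law after the substitution x
  = \<open>sqrt (2 * a) * z\<close>, which turns \<open>- x\<^sup>2 / 2\<close> into
  \<open>- a * z\<^sup>2\<close>.\<close>

lemma gauss_fourier:
  fixes a t :: real
  assumes "a > 0"
  shows "(LINT z|lborel. complex_of_real (exp (- a * z\<^sup>2)) * iexp (t * z))
    = complex_of_real (sqrt (pi / a) * exp (- t\<^sup>2 / (4 * a)))"
proof -
  define c where "c = sqrt (2 * a)"
  have c: "c > 0" "c\<^sup>2 = 2 * a" using assms by (auto simp: c_def)
  define F where "F = (\<lambda>x. std_normal_density x *\<^sub>R iexp ((t / c) * x))"
  have "complex_of_real (exp (- ((t / c)\<^sup>2) / 2)) = char std_normal_distribution (t / c)"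
    by (simp add: char_std_normal_distribution)
  also have "\<dots> = (LINT x|lborel. F x)"
    unfolding char_def F_def by (subst integral_density) auto
  also have "\<dots> = \<bar>c\<bar> *\<^sub>R (LINT z|lborel. F (0 + c * z))"
    using c by (intro lborel_integral_real_affine) simp
  also have "(LINT z|lborel. F (0 + c * z))
      = (LINT z|lborel. complex_of_real (1 / sqrt (2 * pi)) * (complex_of_real (exp (- a * z\<^sup>2)) * iexp (t * z)))"
    using c by (intro Bochner_Integration.integral_cong refl)
      (simp add: F_def std_normal_density_def power_mult_distrib scaleR_conv_of_real mult_ac)
  also have "\<dots> = complex_of_real (1 / sqrt (2 * pi)) * (LINT z|lborel. complex_of_real (exp (- a * z\<^sup>2)) * iexp (t * z))"
    by simp
  finally have "complex_of_real (exp (- ((t / c)\<^sup>2) / 2)) =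
     complex_of_real (c / sqrt (2 * pi)) * (LINT z|lborel. complex_of_real (exp (- a * z\<^sup>2)) * iexp (t * z))"
    using c by (simp add: scaleR_conv_of_real)
  moreover have "- ((t / c)\<^sup>2) / 2 = - t\<^sup>2 / (4 * a)"
    using c by (simp add: power_divide)
  moreover have "sqrt (pi / a) * (c / sqrt (2 * pi)) = 1"
    using assms by (simp add: c_def real_sqrt_divide real_sqrt_mult)
  ultimately show ?thesis
    by (metis (no_types, lifting) mult.assoc mult_1 of_real_1 of_real_mult)
qed

lemma gauss_cos:
  fixes a t :: real
  assumes "a > 0"
  shows "(LINT z|lborel. exp (- a * z\<^sup>2) * cos (t * z)) = sqrt (pi / a) * exp (- t\<^sup>2 / (4 * a))"
proof -
  have "integrable lborel (\<lambda>z. complex_of_real (exp (- a * z\<^sup>2)) * iexp (t * z))"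
    by (rule Bochner_Integration.integrable_bound[OF gauss_integrable(1)[OF assms]])
      (auto simp: norm_mult)
  then have "Re (LINT z|lborel. complex_of_real (exp (- a * z\<^sup>2)) * iexp (t * z))
    = (LINT z|lborel. Re (complex_of_real (exp (- a * z\<^sup>2)) * iexp (t * z)))"
    by (rule integral_Re[symmetric])
  then show ?thesis
    unfolding gauss_fourier[OF assms] by (simp add: Re_exp)
qed

text \<open>Stands for the completely monotone functions, i.e. the Laplace transforms of measures: the
  closure properties below are all that is used, so Bernstein's theorem is avoided.\<close>

inductive exp_mixture :: "(real \<Rightarrow> real) \<Rightarrow> bool" where
  exp: "u \<ge> 0 \<Longrightarrow> exp_mixture (\<lambda>s. exp (- u * s))"
| add: "exp_mixture f \<Longrightarrow> exp_mixture g \<Longrightarrow> exp_mixture (\<lambda>s. f s + g s)"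
| scale: "c \<ge> 0 \<Longrightarrow> exp_mixture f \<Longrightarrow> exp_mixture (\<lambda>s. c * f s)"
| lim: "(\<And>k. exp_mixture (F k)) \<Longrightarrow> (\<And>(k::nat) s. s > 0 \<Longrightarrow> \<bar>F k s\<bar> \<le> C) \<Longrightarrow>
    (\<And>s. s > 0 \<Longrightarrow> (\<lambda>k. F k s) \<longlonglongrightarrow> f s) \<Longrightarrow> f \<in> borel_measurable borel \<Longrightarrow> exp_mixture f"

lemma exp_mixture_measurable: "exp_mixture f \<Longrightarrow> f \<in> borel_measurable borel"
  by (induction rule: exp_mixture.induct) auto

lemma exp_mixture_bounded: "exp_mixture f \<Longrightarrow> \<exists>C. \<forall>s>0. \<bar>f s\<bar> \<le> C"
proof (induction rule: exp_mixture.induct)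
  case (exp u)
  then show ?case by (intro exI[of _ 1]) auto
next
  case (add f g)
  then obtain C D where "\<forall>s>0. \<bar>f s\<bar> \<le> C" "\<forall>s>0. \<bar>g s\<bar> \<le> D" by blast
  then show ?case by (intro exI[of _ "C + D"]) (meson abs_triangle_ineq add_mono order_trans)
next
  case (scale c f)
  then obtain C where "\<forall>s>0. \<bar>f s\<bar> \<le> C" by blast
  then show ?case using scale by (intro exI[of _ "c * C"]) (auto simp: abs_mult intro: mult_left_mono)
next
  case (lim F C f)
  have "\<bar>f s\<bar> \<le> C" if "s > 0" for s
    using tendsto_rabs[OF lim(3)[OF that]] lim(2)[OF that]
    by (intro LIMSEQ_le_const2) auto
  then show ?case by blast
qed

text \<open>Multiplication by \<open>exp (- u * s)\<close> sends generators to generators and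
  respects sums, multiples and bounded limits. It is the base case of the induction on the other
  factor of a product.\<close>

lemma exp_mixture_mult_exp:
  assumes "u \<ge> 0" "exp_mixture g"
  shows "exp_mixture (\<lambda>s. exp (- u * s) * g s)"
  using assms(2)
proof (induction rule: exp_mixture.induct)
  case (exp v)
  then show ?case
    using exp_mixture.exp[of "u + v"] assms(1) by (simp add: exp_add[symmetric] algebra_simps)
next
  case (add f g)
  then show ?case
    using exp_mixture.add[OF add(3,4)] by (simp add: distrib_left)
next
  case (scale c f)
  then show ?case
    using exp_mixture.scale[OF scale(1,3)] by (simp add: mult_ac)
next
  case (lim F C f)
  show ?case
  proof (rule exp_mixture.lim[where C = C and F = "\<lambda>k s. exp (- u * s) * F k s"])
    fix k and s :: real assume s: "s > 0"
    have "exp (- u * s) \<le> 1" using s assms(1) by simp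
    moreover have "\<bar>F k s\<bar> \<le> C" using lim(2)[OF s] .
    ultimately have "exp (- u * s) * \<bar>F k s\<bar> \<le> 1 * C" by (intro mult_mono) auto
    then show "\<bar>exp (- u * s) * F k s\<bar> \<le> C" by (simp add: abs_mult)
  qed (use lim in \<open>auto intro!: tendsto_intros\<close>)
qed

lemma exp_mixture_mult:
  assumes "exp_mixture f" "exp_mixture g"
  shows "exp_mixture (\<lambda>s. f s * g s)"
  using assms(1)
proof (induction rule: exp_mixture.induct)
  case (exp u)
  then show ?case using exp_mixture_mult_exp assms(2) by blast
next
  case (add f f')
  then show ?case using exp_mixture.add[OF add(3,4)] by (simp add: distrib_right)
next
  case (scale c f)
  then show ?case using exp_mixture.scale[OF scale(1,3)] by (simp add: mult_ac)
next
  case (lim F C f)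
  obtain D where D: "\<forall>s>0. \<bar>g s\<bar> \<le> D" using exp_mixture_bounded[OF assms(2)] by blast
  show ?case
  proof (rule exp_mixture.lim[where C = "C * D" and F = "\<lambda>k s. F k s * g s"])
    fix k and s :: real assume s: "s > 0"
    have "\<bar>F k s\<bar> \<le> C" "\<bar>g s\<bar> \<le> D" using lim(2)[OF s] s D by auto
    then show "\<bar>F k s * g s\<bar> \<le> C * D" unfolding abs_mult by (intro mult_mono) auto
  qed (use lim exp_mixture_measurable[OF assms(2)] in \<open>auto intro!: tendsto_intros\<close>)
qed

lemma exp_mixture_1: "exp_mixture (\<lambda>_. 1)"
  using exp_mixture.exp[of 0] by simp

lemma exp_mixture_power: "exp_mixture f \<Longrightarrow> exp_mixture (\<lambda>s. f s ^ k)"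
  by (induction k) (auto intro: exp_mixture_1 exp_mixture_mult)

lemma exp_mixture_sum:
  "finite A \<Longrightarrow> (\<And>i. i \<in> A \<Longrightarrow> exp_mixture (f i)) \<Longrightarrow> exp_mixture (\<lambda>s. \<Sum>i\<in>A. f i s)"
proof (induction A rule: finite_induct)
  case empty
  then show ?case using exp_mixture.scale[OF _ exp_mixture_1, of 0] by simp
qed (auto intro: exp_mixture.add)

text \<open>The partial sums are mixtures by closure under powers and sums. Since all terms are
  nonnegative, they stay below the full sum, hence below \<open>C\<close>, which supplies the
  uniform bound demanded of limits.\<close>

lemma exp_mixture_power_series:
  assumes f: "exp_mixture f" and f0: "\<And>s. s > 0 \<Longrightarrow> f s \<ge> 0"
    and a: "\<And>k. a k \<ge> 0"
    and s: "\<And>s. s > 0 \<Longrightarrow> (\<lambda>k. a k * f s ^ k) sums g s"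
    and C: "\<And>s. s > 0 \<Longrightarrow> g s \<le> C"
    and g: "g \<in> borel_measurable borel"
  shows "exp_mixture g"
proof (rule exp_mixture.lim[where F = "\<lambda>n s. \<Sum>k<n. a k * f s ^ k" and C = C])
  fix n and x :: real assume x: "x > 0"
  have "(\<Sum>k<n. a k * f x ^ k) \<le> (\<Sum>k. a k * f x ^ k)"
    using s[OF x] a f0[OF x] by (intro sum_le_suminf) (auto simp: sums_iff)
  moreover have "(\<Sum>k<n. a k * f x ^ k) \<ge> 0"
    using a f0[OF x] by (intro sum_nonneg) auto
  ultimately show "\<bar>\<Sum>k<n. a k * f x ^ k\<bar> \<le> C"
    using C[OF x] s[OF x] by (auto simp: sums_iff)
qed (use s g f in \<open>auto simp: sums_def intro!: exp_mixture_sum exp_mixture.scale a exp_mixture_power\<close>)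

section \<open>Fractional powers in the exponent: \<open>exp (- (s powr a))\<close> for 0 < a <
  1\<close>

text \<open>In a (a - 1) ... (a - k) only the first factor is positive, so the signs alternate and
  \<open>1 - (1 - x) powr a\<close> has nonnegative coefficients. For a > 1 the coefficient of the
  square is already negative; with a = p / 2 this is where p < 2 first matters.\<close>

lemma gbinomial_alternating_nonpos:
  fixes a :: real
  assumes "0 < a" "a < 1"
  shows "(- 1) ^ Suc k * (a gchoose Suc k) \<le> 0"
proof (induction k)
  case 0
  then show ?case using assms by simp
next
  case (Suc k)
  have "(a gchoose Suc (Suc k)) = (a gchoose Suc k) * (a - real (Suc k)) / real (Suc (Suc k))"
    using gbinomial_mult_1[of a "Suc k"] by (simp add: field_simps)
  then have "(- 1) ^ Suc (Suc k) * (a gchoose Suc (Suc k)) =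
      ((- 1) ^ Suc k * (a gchoose Suc k)) * ((real (Suc k) - a) / real (Suc (Suc k)))"
    by (simp add: right_diff_distrib diff_divide_distrib mult_ac del: of_nat_Suc)
  moreover have "(real (Suc k) - a) / real (Suc (Suc k)) \<ge> 0" using assms by simp
  ultimately show ?case using Suc by (metis mult_nonpos_nonneg)
qed

text \<open>The binomial series needs an argument in (0, 1), so \<open>s\<close> is replaced by N (1
  - x) with x = \<open>exp (- s / N)\<close>, itself a mixture. Two nonnegative power series are
  then composed: the binomial one in x and the exponential one in its value.\<close>

lemma exp_mixture_stable_approx:
  fixes a N :: real
  assumes a: "0 < a" "a < 1" and N: "N > 0"
  shows "exp_mixture (\<lambda>s. exp (- (N powr a * (1 - exp (- (1 / N) * s)) powr a)))"
proof -
  define x where "x = (\<lambda>s. exp (- (1 / N) * s))"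
  have x: "exp_mixture x" unfolding x_def using N by (intro exp_mixture.exp) auto
  have x01: "0 < x s" "x s < 1" if "s > 0" for s using that N by (auto simp: x_def)
  have [measurable]: "x \<in> borel_measurable borel" by (simp add: x_def)
  \<comment> \<open>The 1 in front of \<open>(1 - x s) powr a\<close> cancels the constant term of
    the binomial series, and the minus sign makes the other coefficients nonnegative.\<close>
  define b where "b = (\<lambda>k. if k = 0 then 0 else - ((- 1) ^ k * (a gchoose k)))"
  define g where "g = (\<lambda>s. 1 - (1 - x s) powr a)"
  have g: "exp_mixture g"
  proof (rule exp_mixture_power_series[OF x, of b _ 1])
    show "b k \<ge> 0" for k
      using gbinomial_alternating_nonpos[OF a, of "k - 1"] by (cases k) (auto simp: b_def)
    show "g s \<le> 1" for s by (simp add: g_def)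
    show "g \<in> borel_measurable borel" unfolding g_def by measurable
  next
    fix s :: real assume s: "s > 0"
    have "(\<lambda>n. (a gchoose n) * (- x s)^n) sums (1 + - x s) powr a"
      using x01[OF s] by (intro gen_binomial_real) auto
    then have "(\<lambda>n. (if n = 0 then 1 else 0) - (a gchoose n) * (- x s)^n) sums (1 - (1 + - x s) powr a)"
      by (rule sums_diff[OF sums_single[of 0 "\<lambda>_. 1::real"]])
    moreover have "(if n = 0 then 1 else 0) - (a gchoose n) * (- x s)^n = b n * x s ^ n" for n
      by (auto simp: b_def power_minus[of "x s"] mult_ac)
    ultimately show "(\<lambda>n. b n * x s ^ n) sums g s" by (simp add: g_def)
  qed (use x01 in \<open>auto intro: less_imp_le\<close>)
  have g01: "0 \<le> g s" "g s \<le> 1" if "s > 0" for s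
    using x01[OF that] a by (auto simp: g_def powr_le1)
  define c where "c = N powr a"
  have c: "c \<ge> 0" by (simp add: c_def)
  have "exp_mixture (\<lambda>s. exp (c * g s))"
  proof (rule exp_mixture_power_series[OF g g01(1), of "\<lambda>k. c ^ k / fact k" _ "exp c"])
    show "(\<lambda>k. c ^ k / fact k * g s ^ k) sums exp (c * g s)" for s
      using exp_converges[of "c * g s"] by (simp add: power_mult_distrib field_simps)
    show "exp (c * g s) \<le> exp c" if "s > 0" for s
      using mult_left_mono[OF g01(2)[OF that] c] by simp
    show "(\<lambda>s. exp (c * g s)) \<in> borel_measurable borel" unfolding g_def by measurable
  qed (use c in auto)
  \<comment> \<open>The factor \<open>exp (- c)\<close> turns the exponent \<open>c * g s\<close>
    into \<open>c * g s - c = - c * (1 - x s) powr a\<close>.\<close>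
  then have "exp_mixture (\<lambda>s. exp (- c) * exp (c * g s))" by (intro exp_mixture.scale) auto
  then show ?thesis
    by (simp add: c_def g_def x_def exp_add[symmetric] algebra_simps)
qed

text \<open>As N grows, N (1 - exp (- s / N)) tends to s. The approximants are exponentials of
  nonpositive numbers, so 1 is a uniform bound.\<close>

lemma exp_mixture_stable:
  fixes a :: real
  assumes a: "0 < a" "a < 1"
  shows "exp_mixture (\<lambda>s. exp (- (s powr a)))"
proof (rule exp_mixture.lim[where C = 1 and
      F = "\<lambda>k s. exp (- (real (Suc k) powr a * (1 - exp (- (1 / real (Suc k)) * s)) powr a))"])
  fix s :: real assume s: "s > 0"
  have "((\<lambda>N. N * (1 - exp (- (1 / N) * s))) \<longlongrightarrow> s) at_top"
    using s by real_asymp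
  then have "(\<lambda>k. real (Suc k) * (1 - exp (- (1 / real (Suc k)) * s))) \<longlonglongrightarrow> s"
    by (rule filterlim_compose) (intro filterlim_compose[OF filterlim_real_sequentially filterlim_Suc])
  then have "(\<lambda>k. (real (Suc k) * (1 - exp (- (1 / real (Suc k)) * s))) powr a) \<longlonglongrightarrow> s powr a"
    using s by (intro tendsto_powr) auto
  moreover have "(real (Suc k) * (1 - exp (- (1 / real (Suc k)) * s))) powr a =
     real (Suc k) powr a * (1 - exp (- (1 / real (Suc k)) * s)) powr a" for k
    by (rule powr_mult)
  ultimately show "(\<lambda>k. exp (- (real (Suc k) powr a * (1 - exp (- (1 / real (Suc k)) * s)) powr a)))
      \<longlonglongrightarrow> exp (- (s powr a))"
    by (intro tendsto_intros) simp
qed (use exp_mixture_stable_approx[OF a] in auto)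

section \<open>Cosine transforms of Gaussian mixtures\<close>

definition cos_transform :: "(real \<Rightarrow> real) \<Rightarrow> real \<Rightarrow> real" where
  "cos_transform f t = (LINT z|lborel. f z * cos (t * z))"

lemma convex_on_lim:
  fixes F :: "nat \<Rightarrow> real \<Rightarrow> real"
  assumes "\<And>k. convex_on S (F k)" "\<And>x. x \<in> S \<Longrightarrow> (\<lambda>k. F k x) \<longlonglongrightarrow> f x"
  shows "convex_on S f"
proof -
  have S: "convex S" using assms(1)[of 0] convex_on_imp_convex by blast
  have "f ((1 - t) *\<^sub>R x + t *\<^sub>R y) \<le> (1 - t) * f x + t * f y"
    if *: "0 < t" "t < 1" "x \<in> S" "y \<in> S" for t x y
  proof (rule LIMSEQ_le)
    show "(\<lambda>k. F k ((1 - t) *\<^sub>R x + t *\<^sub>R y)) \<longlonglongrightarrow> f ((1 - t) *\<^sub>R x + t *\<^sub>R y)"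
      using * S by (intro assms(2)) (simp add: convex_alt)
    show "(\<lambda>k. (1 - t) * F k x + t * F k y) \<longlonglongrightarrow> (1 - t) * f x + t * f y"
      using * by (intro tendsto_intros assms(2))
    show "\<exists>N. \<forall>n\<ge>N. F n ((1 - t) *\<^sub>R x + t *\<^sub>R y) \<le> (1 - t) * F n x + t * F n y"
      using * convex_onD[OF assms(1)] by auto
  qed
  with S show ?thesis by (auto intro!: convex_onI)
qed

lemma convex_on_exp_affine: "convex_on S (\<lambda>q::real. exp (m * q + b))" if "convex S"
proof -
  have "convex_on UNIV (\<lambda>q::real. exp (m * q + b))"
    by (rule f''_ge0_imp_convex[where f' = "\<lambda>q. m * exp (m * q + b)" and f'' = "\<lambda>q. m * (m * exp (m * q + b))"])
       (auto intro!: derivative_eq_intros simp: mult.assoc[symmetric])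
  then show ?thesis using that by (meson convex_on_subset subset_UNIV)
qed

text \<open>A mixture is merely bounded (the constant 1 is one), so the Gaussian factor has to
  provide the decay. Its bound holds only at positive arguments, whence the exclusion of the null
  set z = 0.\<close>

lemma exp_mixture_regularized_integrable:
  assumes f: "exp_mixture f" and "d > 0"
  shows "integrable lborel (\<lambda>z. exp (- d * z\<^sup>2) * f (z\<^sup>2) * cos (t * z))"
proof -
  note [measurable] = exp_mixture_measurable[OF f]
  obtain C where C: "\<forall>s>0. \<bar>f s\<bar> \<le> C" using exp_mixture_bounded[OF f] by blast
  have ae: "AE z in lborel. z \<noteq> (0::real)" by (rule AE_lborel_singleton)
  show ?thesis
  proof (rule Bochner_Integration.integrable_bound)
    show "integrable lborel (\<lambda>z. C * exp (- d * z\<^sup>2))"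
      using gauss_integrable(1)[OF assms(2)] by simp
    show "AE z in lborel. norm (exp (- d * z\<^sup>2) * f (z\<^sup>2) * cos (t * z)) \<le> norm (C * exp (- d * z\<^sup>2))"
      using ae
    proof eventually_elim
      case (elim z)
      then have "\<bar>f (z\<^sup>2)\<bar> \<le> C" using C by simp
      then have "\<bar>f (z\<^sup>2)\<bar> * \<bar>cos (t * z)\<bar> \<le> C * 1"
        by (intro mult_mono) auto
      then have "exp (- d * z\<^sup>2) * (\<bar>f (z\<^sup>2)\<bar> * \<bar>cos (t * z)\<bar>) \<le> exp (- d * z\<^sup>2) * \<bar>C\<bar>"
        by (intro mult_left_mono) auto
      then show ?case by (simp add: abs_mult mult_ac)
    qed
  qed measurable
qed

text \<open>Convexity of \<open>exp (\<lambda> q) * g q\<close> for every \<open>\<lambda>\<close> is log-convexity of \<open>g\<close>, in a form that is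
  visibly preserved by sums and limits.\<close>

lemma exp_mixture_cos_transform_convex:
  assumes "exp_mixture f" and d: "d > 0"
  shows "convex_on {0..} (\<lambda>q. exp (l * q) * cos_transform (\<lambda>z. exp (- d * z\<^sup>2) * f (z\<^sup>2)) (sqrt q))
    \<and> (\<forall>t. 0 \<le> cos_transform (\<lambda>z. exp (- d * z\<^sup>2) * f (z\<^sup>2)) t)"
  using assms(1)
proof (induction rule: exp_mixture.induct)
  case (exp u)
  have ct: "cos_transform (\<lambda>z. exp (- d * z\<^sup>2) * exp (- u * z\<^sup>2)) t
     = sqrt (pi / (d + u)) * exp (- t\<^sup>2 / (4 * (d + u)))" for t
    using gauss_cos[of "d + u" t] d exp by (simp add: cos_transform_def exp_add[symmetric] algebra_simps)
  have eq: "exp (l * q) * cos_transform (\<lambda>z. exp (- d * z\<^sup>2) * exp (- u * z\<^sup>2)) (sqrt q)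
      = sqrt (pi / (d + u)) * exp ((l - 1 / (4 * (d + u))) * q + 0)" if "q \<ge> 0" for q
    using that unfolding ct by (simp add: exp_add[symmetric] algebra_simps)
  have "convex_on {0..} (\<lambda>q. sqrt (pi / (d + u)) * exp ((l - 1 / (4 * (d + u))) * q + 0))"
    using d exp by (intro convex_on_cmul convex_on_exp_affine) auto
  then have "convex_on {0..} (\<lambda>q. exp (l * q) * cos_transform (\<lambda>z. exp (- d * z\<^sup>2) * exp (- u * z\<^sup>2)) (sqrt q))"
    unfolding convex_on_def using eq by auto
  then show ?case using ct d exp by simp
next
  case (add f g)
  have eq: "cos_transform (\<lambda>z. exp (- d * z\<^sup>2) * (f (z\<^sup>2) + g (z\<^sup>2))) t =
      cos_transform (\<lambda>z. exp (- d * z\<^sup>2) * f (z\<^sup>2)) t + cos_transform (\<lambda>z. exp (- d * z\<^sup>2) * g (z\<^sup>2)) t" for t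
    unfolding cos_transform_def distrib_left distrib_right
    using add(1,2) d by (intro Bochner_Integration.integral_add exp_mixture_regularized_integrable)
  show ?case unfolding eq unfolding distrib_left using add by (auto intro!: convex_on_add)
next
  case (scale c f)
  have eq: "cos_transform (\<lambda>z. exp (- d * z\<^sup>2) * (c * f (z\<^sup>2))) t =
      c * cos_transform (\<lambda>z. exp (- d * z\<^sup>2) * f (z\<^sup>2)) t" for t
  proof -
    have "cos_transform (\<lambda>z. exp (- d * z\<^sup>2) * (c * f (z\<^sup>2))) t =
       (LINT z|lborel. c * (exp (- d * z\<^sup>2) * f (z\<^sup>2) * cos (t * z)))"
      unfolding cos_transform_def by (simp add: mult_ac)
    then show ?thesis by (simp add: cos_transform_def)
  qed
  have "convex_on {0..} (\<lambda>q. c * (exp (l * q) * cos_transform (\<lambda>z. exp (- d * z\<^sup>2) * f (z\<^sup>2)) (sqrt q)))"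
    using scale by (intro convex_on_cmul) auto
  then show ?case unfolding eq using scale by (auto simp: mult_ac)
next
  case (lim F C f)
  note [measurable] = exp_mixture_measurable[OF lim(1)] lim(4)
  have ae: "AE z in lborel. z \<noteq> (0::real)" by (rule AE_lborel_singleton)
  have conv: "(\<lambda>k. cos_transform (\<lambda>z. exp (- d * z\<^sup>2) * F k (z\<^sup>2)) t) \<longlonglongrightarrow>
      cos_transform (\<lambda>z. exp (- d * z\<^sup>2) * f (z\<^sup>2)) t" for t
    unfolding cos_transform_def
  proof (rule integral_dominated_convergence[where w = "\<lambda>z. C * exp (- d * z\<^sup>2)"])
    show "integrable lborel (\<lambda>z. C * exp (- d * z\<^sup>2))" using gauss_integrable(1)[OF d] by simp
    show "AE z in lborel. (\<lambda>i. exp (- d * z\<^sup>2) * F i (z\<^sup>2) * cos (t * z)) \<longlonglongrightarrow> exp (- d * z\<^sup>2) * f (z\<^sup>2) * cos (t * z)"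
      using ae by eventually_elim (auto intro!: tendsto_intros lim)
    show "AE z in lborel. norm (exp (- d * z\<^sup>2) * F i (z\<^sup>2) * cos (t * z)) \<le> C * exp (- d * z\<^sup>2)" for i
      using ae
    proof eventually_elim
      case (elim z)
      then have "\<bar>F i (z\<^sup>2)\<bar> \<le> C" using lim(2) elim by simp
      then have "\<bar>F i (z\<^sup>2)\<bar> * \<bar>cos (t * z)\<bar> \<le> C * 1"
        by (intro mult_mono) auto
      then have "exp (- d * z\<^sup>2) * (\<bar>F i (z\<^sup>2)\<bar> * \<bar>cos (t * z)\<bar>) \<le> exp (- d * z\<^sup>2) * C"
        by (intro mult_left_mono) auto
      then show ?case by (simp add: abs_mult mult_ac)
    qed
  qed measurable
  have "convex_on {0..} (\<lambda>q. exp (l * q) * cos_transform (\<lambda>z. exp (- d * z\<^sup>2) * f (z\<^sup>2)) (sqrt q))"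
    by (rule convex_on_lim[where
        F = "\<lambda>k q. exp (l * q) * cos_transform (\<lambda>z. exp (- d * z\<^sup>2) * F k (z\<^sup>2)) (sqrt q)"])
      (use lim.IH in \<open>auto intro!: tendsto_intros conv[simplified]\<close>)
  moreover have "0 \<le> cos_transform (\<lambda>z. exp (- d * z\<^sup>2) * f (z\<^sup>2)) t" for t
    using lim.IH by (intro LIMSEQ_le_const[OF conv]) auto
  ultimately show ?case by blast
qed

section \<open>The transform \<open>gamma_p\<close>\<close>

text \<open>\<open>exp (- a)\<close> is the integral of \<open>exp (- r)\<close> over r \<ge> a;
  Tonelli's theorem exchanges this with the integral over \<open>M\<close>. Layers with r < 0 are
  empty because \<open>g\<close> is nonnegative.\<close>

lemma nn_integral_exp_minus_layer_cake:
  assumes "sigma_finite_measure M" and g[measurable]: "g \<in> borel_measurable M"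
    and g0: "\<And>x. x \<in> space M \<Longrightarrow> g x \<ge> (0::real)"
  shows "(\<integral>\<^sup>+x. ennreal (exp (- g x)) \<partial>M)
    = (\<integral>\<^sup>+r. ennreal (exp (- r)) * indicator {0..} r * emeasure M {x \<in> space M. g x \<le> r} \<partial>lborel)"
proof -
  interpret M: sigma_finite_measure M by fact
  interpret P: pair_sigma_finite M lborel ..
  have "(\<integral>\<^sup>+r. ennreal (exp (- r)) * indicator {a..} r \<partial>lborel) = ennreal (exp (- a))" for a :: real
  proof -
    have "((\<lambda>r::real. - exp (- r)) \<longlongrightarrow> 0) at_top" by real_asymp
    then have "(\<integral>\<^sup>+r. ennreal (exp (- r)) * indicator {a..} r \<partial>lborel) = ennreal (0 - (- exp (- a)))"
      by (intro nn_integral_FTC_atLeast) (auto intro!: derivative_eq_intros)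
    then show ?thesis by simp
  qed
  then have "(\<integral>\<^sup>+x. ennreal (exp (- g x)) \<partial>M)
      = (\<integral>\<^sup>+x. (\<integral>\<^sup>+r. ennreal (exp (- r)) * indicator {p. g (fst p) \<le> snd p} (x, r) \<partial>lborel) \<partial>M)"
    by (intro nn_integral_cong) (auto simp: indicator_def)
  also have "\<dots> = (\<integral>\<^sup>+r. (\<integral>\<^sup>+x. ennreal (exp (- r)) * indicator {p. g (fst p) \<le> snd p} (x, r) \<partial>M) \<partial>lborel)"
  proof (rule P.Fubini'[symmetric])
    have [measurable]: "(\<lambda>p. g (fst p)) \<in> borel_measurable (M \<Otimes>\<^sub>M lborel)" by measurable
    have "{p \<in> space (M \<Otimes>\<^sub>M lborel). g (fst p) \<le> snd p} \<in> sets (M \<Otimes>\<^sub>M lborel)" by measurable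
    then have "(\<lambda>p. ennreal (exp (- snd p)) * indicator {p \<in> space (M \<Otimes>\<^sub>M lborel). g (fst p) \<le> snd p} p)
       \<in> borel_measurable (M \<Otimes>\<^sub>M lborel)" by measurable
    then show "(\<lambda>(x, r). ennreal (exp (- r)) * indicator {p. g (fst p) \<le> snd p} (x, r))
       \<in> borel_measurable (M \<Otimes>\<^sub>M lborel)"
      by (rule measurable_cong[THEN iffD1, rotated]) (auto simp: indicator_def)
  qed
  also have "\<dots> = (\<integral>\<^sup>+r. ennreal (exp (- r)) * indicator {0..} r * emeasure M {x \<in> space M. g x \<le> r} \<partial>lborel)"
  proof (intro nn_integral_cong)
    fix r :: real
    have "(\<integral>\<^sup>+x. ennreal (exp (- r)) * indicator {p. g (fst p) \<le> snd p} (x, r) \<partial>M)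
       = (\<integral>\<^sup>+x. ennreal (exp (- r)) * indicator {x \<in> space M. g x \<le> r} x \<partial>M)"
      by (intro nn_integral_cong) (auto simp: indicator_def)
    also have "\<dots> = ennreal (exp (- r)) * emeasure M {x \<in> space M. g x \<le> r}"
      by (intro nn_integral_cmult_indicator) measurable
    also have "\<dots> = ennreal (exp (- r)) * indicator {0..} r * emeasure M {x \<in> space M. g x \<le> r}"
    proof (cases "r \<ge> 0")
      case False
      then have empty: "{x \<in> space M. g x \<le> r} = {}" using g0 by force
      show ?thesis unfolding empty by simp
    qed simp
    finally show "(\<integral>\<^sup>+x. ennreal (exp (- r)) * indicator {p. g (fst p) \<le> snd p} (x, r) \<partial>M) = \<dots>" .
  qed
  finally show ?thesis .
qed

text \<open>For layers of measure \<open>r powr d\<close> times \<open>V\<close>, the layer-cake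
  formula is Euler's integral for \<open>Gamma (1 + d)\<close>. \<open>V\<close> is an extended
  number, so that finiteness of the section volume can be read off from this equation.\<close>

lemma nn_integral_exp_minus_homogeneous:
  assumes "sigma_finite_measure M" and g[measurable]: "g \<in> borel_measurable M"
    and g0: "\<And>x. x \<in> space M \<Longrightarrow> g x \<ge> (0::real)" and d: "d > -1"
    and hom: "\<And>r. r > 0 \<Longrightarrow> emeasure M {x \<in> space M. g x \<le> r} = ennreal (r powr d) * V"
  shows "(\<integral>\<^sup>+x. ennreal (exp (- g x)) \<partial>M) = ennreal (Gamma (1 + d)) * V"
proof -
  have "(\<integral>\<^sup>+x. ennreal (exp (- g x)) \<partial>M)
    = (\<integral>\<^sup>+r. ennreal (exp (- r)) * indicator {0..} r * emeasure M {x \<in> space M. g x \<le> r} \<partial>lborel)"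
    by (intro nn_integral_exp_minus_layer_cake assms)
  also have "\<dots> = (\<integral>\<^sup>+r. ennreal (indicator {0..} r * r powr (1 + d - 1) / exp r) * V \<partial>lborel)"
  \<comment> \<open>The scaling law speaks only of r > 0, so the null set r = 0 is
    discarded.\<close>
  proof (rule nn_integral_cong_AE, use AE_lborel_singleton[of "0::real"] in eventually_elim)
    fix r :: real assume "r \<noteq> 0"
    then show "ennreal (exp (- r)) * indicator {0..} r * emeasure M {x \<in> space M. g x \<le> r}
       = ennreal (indicator {0..} r * r powr (1 + d - 1) / exp r) * V"
      using hom[of r] by (cases "r > 0")
        (auto simp: exp_minus divide_inverse ennreal_mult mult_ac)
  qed
  also have "\<dots> = (\<integral>\<^sup>+r. ennreal (indicator {0..} r * r powr (1 + d - 1) / exp r) \<partial>lborel) * V"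
    by (intro nn_integral_multc) measurable
  also have "\<dots> = ennreal (Gamma (1 + d)) * V"
    using Gamma_conv_nn_integral_real[of "1 + d"] d by simp
  finally show ?thesis .
qed

text \<open>On the line the layers are intervals of length \<open>2 * (r / c) powr (1 / p)\<close>,
  the homogeneous case with d = 1 / p. General \<open>c\<close> serves the majorant \<open>G\<close>
  of the hyperplane integrals.\<close>

lemma exp_minus_abs_powr_integral:
  fixes p c :: real
  assumes "p > 0" "c > 0"
  shows "integrable lborel (\<lambda>z. exp (- (c * \<bar>z\<bar> powr p)))"
    and "(LINT z|lborel. exp (- (c * \<bar>z\<bar> powr p))) = 2 * Gamma (1 + 1 / p) / c powr (1 / p)"
proof -
  have "(\<integral>\<^sup>+z. ennreal (exp (- (c * \<bar>z\<bar> powr p))) \<partial>lborel) = ennreal (Gamma (1 + 1 / p)) * ennreal (2 / c powr (1 / p))"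
  proof (rule nn_integral_exp_minus_homogeneous)
    fix r :: real assume r: "r > 0"
    have "c * \<bar>z\<bar> powr p \<le> r \<longleftrightarrow> \<bar>z\<bar> \<le> (r / c) powr (1 / p)" for z
    proof -
      have "c * \<bar>z\<bar> powr p \<le> r \<longleftrightarrow> \<bar>z\<bar> powr p \<le> r / c"
        using assms by (simp add: field_simps)
      also have "r / c = ((r / c) powr (1 / p)) powr p"
        using assms r by (simp add: powr_powr)
      also have "\<bar>z\<bar> powr p \<le> \<dots> \<longleftrightarrow> \<bar>z\<bar> \<le> (r / c) powr (1 / p)"
        using assms(1) powr_mono2[of p "\<bar>z\<bar>" "(r / c) powr (1 / p)"] powr_less_mono2[of p "(r / c) powr (1 / p)" "\<bar>z\<bar>"]
        by (meson abs_ge_zero less_imp_le not_le powr_ge_zero)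
      finally show ?thesis .
    qed
    then have "{z \<in> space lborel. c * \<bar>z\<bar> powr p \<le> r} = {z. \<bar>z\<bar> \<le> (r / c) powr (1 / p)}"
      by simp
    also have "\<dots> = {- ((r / c) powr (1 / p)) .. (r / c) powr (1 / p)}"
      by (auto simp only: abs_le_iff mem_Collect_eq atLeastAtMost_iff minus_le_iff)
    finally have "emeasure lborel {z \<in> space lborel. c * \<bar>z\<bar> powr p \<le> r} = ennreal (2 * (r / c) powr (1 / p))"
      by simp
    also have "2 * (r / c) powr (1 / p) = r powr (1 / p) * (2 / c powr (1 / p))"
      using r assms by (simp add: powr_divide)
    finally show "emeasure lborel {z \<in> space lborel. c * \<bar>z\<bar> powr p \<le> r} = ennreal (r powr (1 / p)) * ennreal (2 / c powr (1 / p))"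
      by (simp only: ennreal_mult'[OF powr_ge_zero])
  next
    have "1 / p > 0" using assms by simp
    then show "- 1 < 1 / p" by linarith
  qed (use assms in \<open>auto intro: lborel.sigma_finite_measure_axioms\<close>)
  also have "\<dots> = ennreal (2 * Gamma (1 + 1 / p) / c powr (1 / p))"
    using assms by (simp add: ennreal_mult'[symmetric] Gamma_real_pos less_imp_le mult_ac add_pos_pos)
  finally have *: "(\<integral>\<^sup>+z. ennreal (exp (- (c * \<bar>z\<bar> powr p))) \<partial>lborel) = ennreal (2 * Gamma (1 + 1 / p) / c powr (1 / p))" .
  then show "integrable lborel (\<lambda>z. exp (- (c * \<bar>z\<bar> powr p)))"
    by (intro integrableI_nn_integral_finite[OF _ _ *]) auto
  have "2 * Gamma (1 + 1 / p) / c powr (1 / p) \<ge> 0"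
    using assms by (simp add: Gamma_real_pos less_imp_le add_pos_pos)
  with * show "(LINT z|lborel. exp (- (c * \<bar>z\<bar> powr p))) = 2 * Gamma (1 + 1 / p) / c powr (1 / p)"
    by (intro integral_eq_nn_integral[THEN trans]) auto
qed

lemmas exp_minus_powr_integrable = exp_minus_abs_powr_integral(1)[where c = 1, simplified]

lemma gamma_p_fourier:
  "complex_of_real (gamma_p p t) = (LINT z|lborel. complex_of_real (exp (- (\<bar>z\<bar> powr p))) * iexp (- (t * z)))"
  unfolding complex_of_real_gamma_p by (simp add: mult_ac)

lemma gamma_p_conv_cos:
  assumes "p > 0"
  shows "gamma_p p t = cos_transform (\<lambda>z. exp (- (\<bar>z\<bar> powr p))) t"
proof -
  have "integrable lborel (\<lambda>z. complex_of_real (exp (- (\<bar>z\<bar> powr p))) * iexp (- (t * z)))"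
    by (rule Bochner_Integration.integrable_bound[OF exp_minus_powr_integrable[OF assms]])
      (auto simp: norm_mult)
  then have "gamma_p p t = (LINT z|lborel. Re (complex_of_real (exp (- (\<bar>z\<bar> powr p))) * iexp (- (t * z))))"
    by (metis Re_complex_of_real gamma_p_fourier integral_Re)
  then show ?thesis unfolding cos_transform_def by (simp add: Re_exp)
qed

lemma gamma_p_0: "p > 0 \<Longrightarrow> gamma_p p 0 = 2 * Gamma (1 + 1 / p)"
  using exp_minus_abs_powr_integral(2)[of p 1] by (simp add: gamma_p_conv_cos cos_transform_def)

lemma gamma_p_minus: "p > 0 \<Longrightarrow> gamma_p p (- t) = gamma_p p t"
  by (simp add: gamma_p_conv_cos cos_transform_def)

lemma gamma_p_abs: "p > 0 \<Longrightarrow> gamma_p p \<bar>t\<bar> = gamma_p p t"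
  by (simp add: abs_if gamma_p_minus)

lemma gamma_p_tendsto:
  assumes p: "p > 0" and "X \<longlonglongrightarrow> t"
  shows "(\<lambda>k. gamma_p p (X k)) \<longlonglongrightarrow> gamma_p p t"
  unfolding gamma_p_conv_cos[OF p] cos_transform_def
proof (rule integral_dominated_convergence[OF _ _ exp_minus_powr_integrable[OF p]])
  show "AE z in lborel. (\<lambda>k. exp (- (\<bar>z\<bar> powr p)) * cos (X k * z)) \<longlonglongrightarrow> exp (- (\<bar>z\<bar> powr p)) * cos (t * z)"
    by (intro AE_I2 tendsto_intros assms(2))
  have "exp (- (\<bar>z\<bar> powr p)) * \<bar>cos (X k * z)\<bar> \<le> exp (- (\<bar>z\<bar> powr p)) * 1" for z k
    by (intro mult_left_mono) auto
  then show "AE z in lborel. norm (exp (- (\<bar>z\<bar> powr p)) * cos (X k * z)) \<le> exp (- (\<bar>z\<bar> powr p))" for k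
    by (simp add: abs_mult)
qed auto

lemma gamma_p_continuous: "p > 0 \<Longrightarrow> continuous_on S (gamma_p p)"
  using gamma_p_tendsto by (intro continuous_on_sequentiallyI) (auto simp: o_def)

lemma gamma_p_measurable: "p > 0 \<Longrightarrow> gamma_p p \<in> borel_measurable borel"
  by (intro borel_measurable_continuous_onI gamma_p_continuous)

text \<open>Both properties hold for the transforms regularized by
  \<open>exp (- d k * z\<^sup>2)\<close> and survive pointwise limits. Here the regularization is
  removed by dominated convergence, with \<open>exp (- (\<bar>z\<bar> powr p))\<close> as
  majorant.\<close>

lemma gamma_p_exp_convex:
  assumes p: "0 < p" "p < 2"
  shows "convex_on {0..} (\<lambda>q. exp (l * q) * gamma_p p (sqrt q))" and "0 \<le> gamma_p p t"
proof -
  define f where "f = (\<lambda>s::real. exp (- (s powr (p / 2))))"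
  define d where "d = (\<lambda>k. inverse (real (Suc k)))"
  have d: "d k > 0" for k by (simp add: d_def)
  have d0: "d \<longlonglongrightarrow> 0" unfolding d_def by (rule LIMSEQ_inverse_real_of_nat)
  have f: "exp_mixture f" unfolding f_def using p by (intro exp_mixture_stable) auto
  have fz: "f (z\<^sup>2) = exp (- (\<bar>z\<bar> powr p))" for z
  proof -
    have "(z\<^sup>2) powr (p / 2) = (\<bar>z\<bar> powr 2) powr (p / 2)" by simp
    also have "\<dots> = \<bar>z\<bar> powr p" by (subst powr_powr) simp
    finally show ?thesis by (simp add: f_def)
  qed
  have conv: "(\<lambda>k. cos_transform (\<lambda>z. exp (- d k * z\<^sup>2) * f (z\<^sup>2)) t) \<longlonglongrightarrow> gamma_p p t" for t
    unfolding gamma_p_conv_cos[OF p(1)] cos_transform_def fz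
  proof (rule integral_dominated_convergence[OF _ _ exp_minus_powr_integrable[OF p(1)]])
    have "(\<lambda>k. exp (- d k * z\<^sup>2) * exp (- (\<bar>z\<bar> powr p)) * cos (t * z))
       \<longlonglongrightarrow> exp (- 0 * z\<^sup>2) * exp (- (\<bar>z\<bar> powr p)) * cos (t * z)" for z
      by (intro tendsto_intros d0)
    then show "AE z in lborel. (\<lambda>k. exp (- d k * z\<^sup>2) * exp (- (\<bar>z\<bar> powr p)) * cos (t * z))
       \<longlonglongrightarrow> exp (- (\<bar>z\<bar> powr p)) * cos (t * z)" by simp
    have "exp (- d k * z\<^sup>2) * exp (- (\<bar>z\<bar> powr p)) * \<bar>cos (t * z)\<bar> \<le> 1 * exp (- (\<bar>z\<bar> powr p)) * 1" for k z
      using d[of k] by (intro mult_mono) auto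
    then show "AE z in lborel. norm (exp (- d k * z\<^sup>2) * exp (- (\<bar>z\<bar> powr p)) * cos (t * z))
       \<le> exp (- (\<bar>z\<bar> powr p))" for k by (simp add: abs_mult)
  qed auto
  show "convex_on {0..} (\<lambda>q. exp (l * q) * gamma_p p (sqrt q))"
    by (rule convex_on_lim[where
        F = "\<lambda>k q. exp (l * q) * cos_transform (\<lambda>z. exp (- d k * z\<^sup>2) * f (z\<^sup>2)) (sqrt q)"])
      (use exp_mixture_cos_transform_convex[OF f d] in \<open>auto intro!: tendsto_mult_left conv[simplified]\<close>)
  show "0 \<le> gamma_p p t"
    using exp_mixture_cos_transform_convex[OF f d] by (intro LIMSEQ_le_const[OF conv]) auto
qed

section \<open>Fourier inversion\<close>

text \<open>The Gaussian regularization \<open>exp (- d * t\<^sup>2)\<close> turns the integral of the transform into an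
  average of \<open>A\<close> against a Gaussian concentrating at 0 as \<open>d\<close> tends to 0.\<close>

lemma fourier_regularized:
  fixes A :: "real \<Rightarrow> real" and \<phi> :: "real \<Rightarrow> complex"
  assumes A: "integrable lborel A" and d: "d > 0"
    and \<phi>: "\<And>t. \<phi> t = (LINT r|lborel. complex_of_real (A r) * iexp (- (t * r)))"
  shows "(LINT t|lborel. complex_of_real (exp (- d * t\<^sup>2)) * \<phi> t)
     = complex_of_real (2 * sqrt pi * (LINT u|lborel. A (2 * sqrt d * u) * exp (- u\<^sup>2)))"
proof -
  note [measurable] = borel_measurable_integrable[OF A]
  define K where "K = (\<lambda>t r. complex_of_real (exp (- d * t\<^sup>2)) * (complex_of_real (A r) * iexp (- (t * r))))"
  have K: "integrable (lborel \<Otimes>\<^sub>M lborel) (case_prod K)"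
  proof (rule lborel_pair.Fubini_integrable)
    show "case_prod K \<in> borel_measurable (lborel \<Otimes>\<^sub>M lborel)" unfolding K_def by measurable
    have "(LINT r|lborel. norm (case_prod K (t, r))) = (LINT r|lborel. \<bar>A r\<bar>) * exp (- d * t\<^sup>2)" for t
      by (simp add: K_def norm_mult mult.commute)
    then show "integrable lborel (\<lambda>t. LINT r|lborel. norm (case_prod K (t, r)))"
      using gauss_integrable(1)[OF d] by simp
    have "integrable lborel (\<lambda>r. complex_of_real (A r) * iexp (- (t * r)))" for t
      by (rule Bochner_Integration.integrable_bound[OF A]) (auto simp: norm_mult)
    then show "AE t in lborel. integrable lborel (\<lambda>r. case_prod K (t, r))"
      by (simp add: K_def)
  qed
  have "(LINT t|lborel. complex_of_real (exp (- d * t\<^sup>2)) * \<phi> t) = (LINT t|lborel. LINT r|lborel. K t r)"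
    unfolding \<phi> K_def by simp
  also have "\<dots> = (LINT r|lborel. LINT t|lborel. K t r)"
    using lborel_pair.Fubini_integral[OF K] by simp
  also have "\<dots> = (LINT r|lborel. complex_of_real (A r * (sqrt (pi / d) * exp (- r\<^sup>2 / (4 * d)))))"
  proof (intro Bochner_Integration.integral_cong refl)
    fix r
    have "(LINT t|lborel. K t r) = (LINT t|lborel. complex_of_real (A r) * (complex_of_real (exp (- d * t\<^sup>2)) * iexp (- r * t)))"
      by (simp add: K_def mult_ac)
    also have "\<dots> = complex_of_real (A r) * (LINT t|lborel. complex_of_real (exp (- d * t\<^sup>2)) * iexp (- r * t))"
      by simp
    finally show "(LINT t|lborel. K t r) = complex_of_real (A r * (sqrt (pi / d) * exp (- r\<^sup>2 / (4 * d))))"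
      using gauss_fourier[OF d, of "- r"] by simp
  qed
  also have "\<dots> = complex_of_real (LINT r|lborel. A r * (sqrt (pi / d) * exp (- r\<^sup>2 / (4 * d))))"
    by (rule integral_complex_of_real)
  also have "(LINT r|lborel. A r * (sqrt (pi / d) * exp (- r\<^sup>2 / (4 * d))))
      = \<bar>2 * sqrt d\<bar> *\<^sub>R (LINT u|lborel. A (0 + 2 * sqrt d * u) * (sqrt (pi / d) * exp (- (0 + 2 * sqrt d * u)\<^sup>2 / (4 * d))))"
    using d by (intro lborel_integral_real_affine) simp
  also have "\<dots> = 2 * sqrt d * (LINT u|lborel. sqrt (pi / d) * (A (2 * sqrt d * u) * exp (- u\<^sup>2)))"
    using d by (simp add: power_mult_distrib mult_ac)
  also have "\<dots> = 2 * sqrt pi * (LINT u|lborel. A (2 * sqrt d * u) * exp (- u\<^sup>2))"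
    using d by (simp add: real_sqrt_divide)
  finally show ?thesis .
qed

lemma gauss_average_tendsto:
  fixes A :: "real \<Rightarrow> real"
  assumes A[measurable]: "A \<in> borel_measurable borel" and B: "\<And>r. \<bar>A r\<bar> \<le> B" and cont: "isCont A 0"
    and d0: "d \<longlonglongrightarrow> 0"
  shows "(\<lambda>k. LINT u|lborel. A (2 * sqrt (d k) * u) * exp (- u\<^sup>2)) \<longlonglongrightarrow> A 0 * sqrt pi"
proof -
  have "(\<lambda>k. LINT u|lborel. A (2 * sqrt (d k) * u) * exp (- u\<^sup>2)) \<longlonglongrightarrow> (LINT u|lborel. A 0 * exp (- u\<^sup>2))"
  proof (rule integral_dominated_convergence[where w = "\<lambda>u. B * exp (- u\<^sup>2)"])
    show "integrable lborel (\<lambda>u::real. B * exp (- u\<^sup>2))"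
      using gauss_integrable(1)[of 1] by simp
    have "(\<lambda>k. A (2 * sqrt (d k) * u)) \<longlonglongrightarrow> A 0" for u
    proof (rule isCont_tendsto_compose[OF cont])
      have "(\<lambda>k. 2 * sqrt (d k) * u) \<longlonglongrightarrow> 2 * sqrt 0 * u" by (intro tendsto_intros d0)
      then show "(\<lambda>k. 2 * sqrt (d k) * u) \<longlonglongrightarrow> 0" by simp
    qed
    then show "AE u in lborel. (\<lambda>k. A (2 * sqrt (d k) * u) * exp (- u\<^sup>2)) \<longlonglongrightarrow> A 0 * exp (- u\<^sup>2)"
      by (intro AE_I2 tendsto_intros)
    show "AE u in lborel. norm (A (2 * sqrt (d k) * u) * exp (- u\<^sup>2)) \<le> B * exp (- u\<^sup>2)" for k
      using B by (auto simp: abs_mult intro!: AE_I2 mult_right_mono)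
  qed measurable
  then show ?thesis using gauss_integrable(2)[of 1] by simp
qed

text \<open>Integrability of \<open>\<phi>\<close> lets dominated convergence remove the Gaussian
  factor. This complex version handles translated functions, whose transforms carry a phase and have
  no sign.\<close>

lemma fourier_inversion_at_0:
  fixes A :: "real \<Rightarrow> real" and \<phi> :: "real \<Rightarrow> complex"
  assumes A: "integrable lborel A" and B: "\<And>r. \<bar>A r\<bar> \<le> B" and cont: "isCont A 0"
    and \<phi>: "\<And>t. \<phi> t = (LINT r|lborel. complex_of_real (A r) * iexp (- (t * r)))"
    and int: "integrable lborel \<phi>"
  shows "(LINT t|lborel. \<phi> t) = complex_of_real (2 * pi * A 0)"
proof -
  define d where "d = (\<lambda>k. inverse (real (Suc k)))"
  have d: "d k > 0" for k by (simp add: d_def)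
  have d0: "d \<longlonglongrightarrow> 0" unfolding d_def by (rule LIMSEQ_inverse_real_of_nat)
  note [measurable] = borel_measurable_integrable[OF A] borel_measurable_integrable[OF int]
  have "(\<lambda>k. LINT t|lborel. complex_of_real (exp (- d k * t\<^sup>2)) * \<phi> t) \<longlonglongrightarrow> (LINT t|lborel. \<phi> t)"
  proof (rule integral_dominated_convergence[where w = "\<lambda>t. norm (\<phi> t)"])
    have "(\<lambda>k. complex_of_real (exp (- d k * t\<^sup>2)) * \<phi> t) \<longlonglongrightarrow> complex_of_real (exp (- 0 * t\<^sup>2)) * \<phi> t" for t
      by (intro tendsto_intros d0)
    then show "AE t in lborel. (\<lambda>k. complex_of_real (exp (- d k * t\<^sup>2)) * \<phi> t) \<longlonglongrightarrow> \<phi> t" by simp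
    have "exp (- d k * t\<^sup>2) * norm (\<phi> t) \<le> 1 * norm (\<phi> t)" for k t
      using d[of k] by (intro mult_right_mono) auto
    then show "AE t in lborel. norm (complex_of_real (exp (- d k * t\<^sup>2)) * \<phi> t) \<le> norm (\<phi> t)" for k
      by (simp add: norm_mult)
    show "integrable lborel (\<lambda>t. norm (\<phi> t))" using int by (rule integrable_norm)
  qed measurable
  moreover have "(\<lambda>k. LINT t|lborel. complex_of_real (exp (- d k * t\<^sup>2)) * \<phi> t)
      \<longlonglongrightarrow> complex_of_real (2 * sqrt pi * (A 0 * sqrt pi))"
    unfolding fourier_regularized[OF A d \<phi>]
    by (intro tendsto_intros gauss_average_tendsto[OF _ B cont d0]) measurable
  ultimately have "(LINT t|lborel. \<phi> t) = complex_of_real (2 * sqrt pi * (A 0 * sqrt pi))"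
    by (rule LIMSEQ_unique)
  also have "2 * sqrt pi * (A 0 * sqrt pi) = 2 * pi * A 0" by simp
  finally show ?thesis .
qed

text \<open>As d decreases to 0 the regularized integrands increase to \<open>\<psi>\<close>, while
  \<open>fourier_regularized\<close> shows that their integrals converge to
  \<open>2 * pi * A 0\<close>. Monotone convergence then yields integrability and the value at
  once.\<close>

lemma fourier_nonneg_integrable:
  fixes A \<psi> :: "real \<Rightarrow> real"
  assumes A: "integrable lborel A" and B: "\<And>r. \<bar>A r\<bar> \<le> B" and cont: "isCont A 0"
    and \<psi>: "\<And>t. complex_of_real (\<psi> t) = (LINT r|lborel. complex_of_real (A r) * iexp (- (t * r)))"
    and pos: "\<And>t. \<psi> t \<ge> 0" and m[measurable]: "\<psi> \<in> borel_measurable borel"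
  shows "integrable lborel \<psi>" and "(LINT t|lborel. \<psi> t) = 2 * pi * A 0"
proof -
  define d where "d = (\<lambda>k. inverse (real (Suc k)))"
  have d: "d k > 0" for k by (simp add: d_def)
  have d0: "d \<longlonglongrightarrow> 0" unfolding d_def by (rule LIMSEQ_inverse_real_of_nat)
  note [measurable] = borel_measurable_integrable[OF A]
  define C where "C = (LINT r|lborel. \<bar>A r\<bar>)"
  have \<psi>B: "\<psi> t \<le> C" for t
  proof -
    have "\<psi> t = norm (complex_of_real (\<psi> t))" using pos by simp
    also have "\<dots> \<le> (LINT r|lborel. norm (complex_of_real (A r) * iexp (- (t * r))))"
      unfolding \<psi> by (rule integral_norm_bound)
    finally show ?thesis by (simp add: norm_mult C_def)
  qed
  have int: "integrable lborel (\<lambda>t. exp (- d k * t\<^sup>2) * \<psi> t)" for k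
  proof (rule Bochner_Integration.integrable_bound)
    show "integrable lborel (\<lambda>t. C * exp (- d k * t\<^sup>2))" using gauss_integrable(1)[OF d] by simp
    have "exp (- d k * t\<^sup>2) * \<psi> t \<le> exp (- d k * t\<^sup>2) * \<bar>C\<bar>" for t
      using \<psi>B[of t] by (intro mult_left_mono) auto
    then show "AE t in lborel. norm (exp (- d k * t\<^sup>2) * \<psi> t) \<le> norm (C * exp (- d k * t\<^sup>2))"
      using pos by (auto simp: abs_mult mult_ac)
  qed measurable
  have eq: "(LINT t|lborel. exp (- d k * t\<^sup>2) * \<psi> t) = 2 * sqrt pi * (LINT u|lborel. A (2 * sqrt (d k) * u) * exp (- u\<^sup>2))" for k
  proof -
    have "complex_of_real (LINT t|lborel. exp (- d k * t\<^sup>2) * \<psi> t)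
       = (LINT t|lborel. complex_of_real (exp (- d k * t\<^sup>2) * \<psi> t))"
      by (rule integral_complex_of_real[symmetric])
    also have "\<dots> = (LINT t|lborel. complex_of_real (exp (- d k * t\<^sup>2)) * complex_of_real (\<psi> t))"
      by simp
    also have "\<dots> = complex_of_real (2 * sqrt pi * (LINT u|lborel. A (2 * sqrt (d k) * u) * exp (- u\<^sup>2)))"
      by (rule fourier_regularized[OF A d \<psi>])
    finally show ?thesis by (simp only: of_real_eq_iff)
  qed
  have lim: "(\<lambda>k. LINT t|lborel. exp (- d k * t\<^sup>2) * \<psi> t) \<longlonglongrightarrow> 2 * sqrt pi * (A 0 * sqrt pi)"
    unfolding eq by (intro tendsto_intros gauss_average_tendsto[OF _ B cont d0]) measurable
  have mono: "AE t in lborel. mono (\<lambda>k. exp (- d k * t\<^sup>2) * \<psi> t)"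
  proof (intro AE_I2 monoI)
    fix t :: real and k l :: nat assume "k \<le> l"
    then have "d l \<le> d k" by (simp add: d_def field_simps)
    then have "d l * t\<^sup>2 \<le> d k * t\<^sup>2" by (intro mult_right_mono) auto
    then show "exp (- d k * t\<^sup>2) * \<psi> t \<le> exp (- d l * t\<^sup>2) * \<psi> t"
      using pos by (intro mult_right_mono) auto
  qed
  have conv: "AE t in lborel. (\<lambda>k. exp (- d k * t\<^sup>2) * \<psi> t) \<longlonglongrightarrow> \<psi> t"
  proof (intro AE_I2)
    fix t
    have "(\<lambda>k. exp (- d k * t\<^sup>2) * \<psi> t) \<longlonglongrightarrow> exp (- 0 * t\<^sup>2) * \<psi> t" by (intro tendsto_intros d0)
    then show "(\<lambda>k. exp (- d k * t\<^sup>2) * \<psi> t) \<longlonglongrightarrow> \<psi> t" by simp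
  qed
  have nn: "AE t in lborel. 0 \<le> exp (- d k * t\<^sup>2) * \<psi> t" for k using pos by auto
  show "integrable lborel \<psi>"
    by (rule integral_monotone_convergence_nonneg(1)[OF int mono nn conv lim]) measurable
  show "(LINT t|lborel. \<psi> t) = 2 * pi * A 0"
    using integral_monotone_convergence_nonneg(2)[OF int mono nn conv lim] by simp
qed

lemma exp_minus_powr_continuous:
  assumes "p > 0" shows "continuous_on S (\<lambda>z::real. exp (- (\<bar>z\<bar> powr p)))"
  by (intro continuous_intros continuous_on_powr') (use assms in auto)

text \<open>Inversion at 0 for \<open>exp (- (\<bar>z\<bar> powr p))\<close>, whose value there is
  1. That the result is independent of p is what makes the upper bound explicit.\<close>

lemma gamma_p_integral:
  assumes p: "0 < p" "p < 2"
  shows "integrable lborel (gamma_p p)" and "(LINT t|lborel. gamma_p p t) = 2 * pi"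
proof -
  have c: "isCont (\<lambda>z::real. exp (- (\<bar>z\<bar> powr p))) 0"
    using exp_minus_powr_continuous[OF p(1), of UNIV] by (simp add: continuous_on_eq_continuous_at)
  note * = exp_minus_powr_integrable[OF p(1)] _ c gamma_p_fourier gamma_p_exp_convex(2)[OF p] gamma_p_measurable[OF p(1)]
  show "integrable lborel (gamma_p p)" by (rule fourier_nonneg_integrable(1)[where B = 1, OF *]) simp
  have "(LINT t|lborel. gamma_p p t) = 2 * pi * exp (- (\<bar>0\<bar> powr p))"
    by (rule fourier_nonneg_integrable(2)[where B = 1, OF *]) simp
  then show "(LINT t|lborel. gamma_p p t) = 2 * pi" by simp
qed

text \<open>Translation by \<open>x\<close> moves the point of evaluation to 0 and multiplies the
  transform by \<open>iexp (t * x)\<close>; its integrability is that of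
  \<open>gamma_p p\<close>.\<close>

lemma gamma_p_inversion:
  assumes p: "0 < p" "p < 2"
  shows "(LINT t|lborel. gamma_p p t * cos (t * x)) = 2 * pi * exp (- (\<bar>x\<bar> powr p))"
proof -
  define A where "A = (\<lambda>z. exp (- (\<bar>x + z\<bar> powr p)))"
  define \<phi> where "\<phi> = (\<lambda>t. complex_of_real (gamma_p p t) * iexp (t * x))"
  have c: "isCont A 0"
  proof -
    have "isCont (\<lambda>z::real. exp (- (\<bar>z\<bar> powr p))) (x + 0)"
      using exp_minus_powr_continuous[OF p(1), of UNIV] by (simp add: continuous_on_eq_continuous_at)
    then show ?thesis unfolding A_def by (rule isCont_o2[rotated]) (auto intro!: continuous_intros)
  qed
  have A: "integrable lborel A"
    unfolding A_def using lborel_integrable_real_affine[OF exp_minus_powr_integrable[OF p(1)], of 1 x] by simp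
  have \<phi>: "\<phi> t = (LINT r|lborel. complex_of_real (A r) * iexp (- (t * r)))" for t
  proof -
    have "complex_of_real (gamma_p p t) = (LINT z|lborel. complex_of_real (exp (- (\<bar>x + 1 * z\<bar> powr p))) * iexp (- (t * (x + 1 * z))))"
      unfolding gamma_p_fourier by (subst lborel_integral_real_affine[where c = 1 and t = x]) auto
    then have "\<phi> t = (LINT z|lborel. complex_of_real (exp (- (\<bar>x + 1 * z\<bar> powr p))) * iexp (- (t * (x + 1 * z))) * iexp (t * x))"
      by (simp add: \<phi>_def)
    also have "\<dots> = (LINT r|lborel. complex_of_real (A r) * iexp (- (t * r)))"
      by (intro Bochner_Integration.integral_cong refl) (simp add: A_def mult.assoc exp_add[symmetric] algebra_simps)
    finally show ?thesis .
  qed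
  have int: "integrable lborel \<phi>"
    unfolding \<phi>_def using gamma_p_measurable[OF p(1)]
    by (intro Bochner_Integration.integrable_bound[OF gamma_p_integral(1)[OF p]]) (auto simp: norm_mult)
  have "(LINT t|lborel. \<phi> t) = complex_of_real (2 * pi * A 0)"
    by (rule fourier_inversion_at_0[OF A _ c \<phi> int, of 1]) (simp add: A_def)
  then have "2 * pi * A 0 = Re (LINT t|lborel. \<phi> t)" by simp
  also have "\<dots> = (LINT t|lborel. Re (\<phi> t))" using int by (rule integral_Re[symmetric])
  finally show ?thesis by (simp add: \<phi>_def A_def Re_exp)
qed

lemma gamma_p_not_gaussian:
  assumes p: "0 < p" "p < 2"
  shows "\<not> (\<forall>t. gamma_p p t = C * exp (- b * t\<^sup>2))"
proof
  assume *: "\<forall>t. gamma_p p t = C * exp (- b * t\<^sup>2)"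
  have "1 + 1 / p > 0" using p by (simp add: add_pos_pos)
  then have "Gamma (1 + 1 / p) > 0" by (rule Gamma_real_pos)
  then have C: "C \<noteq> 0" using *[rule_format, of 0] gamma_p_0[OF p(1)] by auto
  \<comment> \<open>For b \<le> 0 the modulus of \<open>gamma_p p\<close> would be at least the
    positive constant \<bar>C\<bar>, contradicting integrability.\<close>
  have b: "b > 0"
  proof (rule ccontr)
    assume "\<not> b > 0"
    then have b: "- b * t\<^sup>2 \<ge> 0" for t by (simp add: mult_nonpos_nonneg)
    have "integrable lborel (\<lambda>t::real. C)"
    proof (rule Bochner_Integration.integrable_bound[OF gamma_p_integral(1)[OF p]])
      have "\<bar>C\<bar> * 1 \<le> \<bar>C\<bar> * exp (- b * t\<^sup>2)" for t using b[of t] by (intro mult_left_mono) auto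
      then show "AE t in lborel. norm C \<le> norm (gamma_p p t)" using * by (simp add: abs_mult)
    qed simp
    then have "integrable lborel (\<lambda>t::real. 1 / C * C)"
      by (rule integrable_mult_right)
    then have "integrable lborel (\<lambda>t::real. 1::real)" using C by simp
    then show False by (simp add: integrable_iff_bounded)
  qed
  define D where "D = C * sqrt (pi / b) / (2 * pi)"
  have "exp (- (\<bar>x\<bar> powr p)) = D * exp (- x\<^sup>2 / (4 * b))" for x
  proof -
    have "2 * pi * exp (- (\<bar>x\<bar> powr p)) = (LINT t|lborel. C * (exp (- b * t\<^sup>2) * cos (x * t)))"
      using gamma_p_inversion[OF p, of x] * by (simp add: mult_ac)
    also have "\<dots> = C * (sqrt (pi / b) * exp (- x\<^sup>2 / (4 * b)))"
      using gauss_cos[OF b, of x] by simp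
    finally show ?thesis by (simp add: D_def field_simps)
  qed
  \<comment> \<open>The value at 0 normalizes \<open>D\<close>, the value at 1 gives 4 b = 1, and
    the value at 2 then says \<open>2 powr p = 4\<close>.\<close>
  from this[of 0] this[of 1] this[of 2] have "D = 1" "1 = 1 / (4 * b)" "2 powr p = 2\<^sup>2 / (4 * b)"
    by auto
  moreover have "2 powr p < (2::real) powr 2" using p by (intro powr_less_mono) auto
  ultimately show False by simp
qed

section \<open>Orthonormal coordinates for Lebesgue measure\<close>

lemma nn_integral_lborel_translate:
  fixes f :: "'a::euclidean_space \<Rightarrow> ennreal"
  assumes "f \<in> borel_measurable borel"
  shows "(\<integral>\<^sup>+x. f (c + x) \<partial>lborel) = (\<integral>\<^sup>+x. f x \<partial>lborel)"
proof -
  have "(\<integral>\<^sup>+x. f x \<partial>lborel) = (\<integral>\<^sup>+x. f x \<partial>distr lborel borel ((+) c))"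
    by (simp add: lborel_distr_plus)
  also have "\<dots> = (\<integral>\<^sup>+x. f (c + x) \<partial>lborel)"
    using assms by (intro nn_integral_distr) auto
  finally show ?thesis by simp
qed

lemma nn_integral_lborel_reflect:
  fixes f :: "'a::euclidean_space \<Rightarrow> ennreal"
  assumes f: "f \<in> borel_measurable borel"
  shows "(\<integral>\<^sup>+x. f (c - x) \<partial>lborel) = (\<integral>\<^sup>+x. f x \<partial>lborel)"
proof -
  have refl: "distr lborel borel uminus = (lborel :: 'a measure)"
    using lborel_affine[of "-1" "0::'a", symmetric] by (simp add: density_1)
  have "(\<integral>\<^sup>+x. f (c - x) \<partial>lborel) = (\<integral>\<^sup>+x. f (c + - x) \<partial>lborel)" by simp
  also have "\<dots> = (\<integral>\<^sup>+x. f (c + x) \<partial>distr lborel borel uminus)"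
    using f by (intro nn_integral_distr[symmetric]) auto
  also have "\<dots> = (\<integral>\<^sup>+x. f x \<partial>lborel)"
    by (simp add: refl nn_integral_lborel_translate[OF f])
  finally show ?thesis .
qed

text \<open>The uniqueness argument for Haar measure: translation invariance and Fubini, with the unit ball
  fixing the normalization.\<close>

lemma nn_integral_lborel_orthogonal:
  fixes T :: "'a::euclidean_space \<Rightarrow> 'a"
  assumes T: "orthogonal_transformation T" and f[measurable]: "f \<in> borel_measurable borel"
  shows "(\<integral>\<^sup>+x. f (T x) \<partial>lborel) = (\<integral>\<^sup>+x. f x \<partial>lborel)"
proof -
  have lin: "linear T" using T by (simp add: orthogonal_transformation_linear)
  then have [measurable]: "T \<in> borel_measurable borel"
    by (intro borel_measurable_continuous_onI linear_continuous_on linear_conv_bounded_linear[THEN iffD1])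
  have T_inv: "T (inv T y) = y" for y
    using orthogonal_transformation_surj[OF T] by (rule surj_f_inv_f)
  define g where "g = (indicator (ball 0 1) :: 'a \<Rightarrow> ennreal)"
  have [measurable]: "g \<in> borel_measurable borel" unfolding g_def by (intro borel_measurable_indicator) simp
  have gT: "g (T x) = g x" for x
    using orthogonal_transformation_norm[OF T] by (simp add: g_def indicator_def)
  define G where "G = (\<integral>\<^sup>+x. g x \<partial>lborel)"
  have G: "G \<noteq> 0" "G \<noteq> \<infinity>"
  proof -
    have G: "G = emeasure lborel (ball (0::'a) 1)" by (simp add: G_def g_def)
    show "G \<noteq> \<infinity>" using emeasure_lborel_ball_finite[of "0::'a" 1] by (simp add: G)
    have "emeasure lborel (ball (0::'a) 1) = ennreal (measure lborel (ball (0::'a) 1))"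
      using emeasure_lborel_ball_finite[of "0::'a" 1] by (intro emeasure_eq_ennreal_measure) auto
    then show "G \<noteq> 0" using content_ball_pos[of 1 "0::'a"] by (simp add: G)
  qed
  have "(\<integral>\<^sup>+x. f (T x) \<partial>lborel) * G = (\<integral>\<^sup>+x. (\<integral>\<^sup>+y. f (T x) * g (T x + y) \<partial>lborel) \<partial>lborel)"
    by (simp add: nn_integral_cmult nn_integral_multc nn_integral_lborel_translate G_def)
  also have "\<dots> = (\<integral>\<^sup>+y. (\<integral>\<^sup>+x. f (T x) * g (T x + y) \<partial>lborel) \<partial>lborel)"
    by (intro lborel_pair.Fubini'[symmetric]) measurable
  \<comment> \<open>For fixed y, shifting x by \<open>- inv T y\<close> shifts \<open>T x\<close> by
    \<open>- y\<close>. This frees \<open>g\<close> of y, and its rotation invariance then removes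
    \<open>T\<close> from it.\<close>
  also have "\<dots> = (\<integral>\<^sup>+y. (\<integral>\<^sup>+x. f (T (- inv T y + x)) * g (T (- inv T y + x) + y) \<partial>lborel) \<partial>lborel)"
    by (subst nn_integral_lborel_translate) auto
  also have "\<dots> = (\<integral>\<^sup>+y. (\<integral>\<^sup>+x. f (T x - y) * g (T x) \<partial>lborel) \<partial>lborel)"
    by (simp add: linear_add[OF lin] linear_neg[OF lin] linear_diff[OF lin] T_inv)
  also have "\<dots> = (\<integral>\<^sup>+x. (\<integral>\<^sup>+y. f (T x - y) * g (T x) \<partial>lborel) \<partial>lborel)"
    by (intro lborel_pair.Fubini') measurable
  also have "\<dots> = (\<integral>\<^sup>+x. f x \<partial>lborel) * G"
    by (simp add: nn_integral_cmult nn_integral_multc nn_integral_lborel_reflect gT G_def)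
  finally show ?thesis
    using G ennreal_mult_cancel_left[of G] by (simp add: mult.commute[of _ G])
qed

lemma lborel_distr_orthogonal:
  fixes T :: "'a::euclidean_space \<Rightarrow> 'a"
  assumes T: "orthogonal_transformation T"
  shows "distr lborel borel T = lborel"
proof (rule measure_eqI)
  have [measurable]: "T \<in> borel_measurable borel"
    using T by (intro borel_measurable_continuous_onI linear_continuous_on linear_conv_bounded_linear[THEN iffD1])
      (simp add: orthogonal_transformation_linear)
  fix A :: "'a set" assume "A \<in> sets (distr lborel borel T)"
  then have [measurable]: "A \<in> sets borel" by simp
  have "emeasure (distr lborel borel T) A = (\<integral>\<^sup>+x. indicator A x \<partial>distr lborel borel T)"
    by simp
  also have "\<dots> = (\<integral>\<^sup>+x. indicator A (T x) \<partial>lborel)" by (intro nn_integral_distr) auto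
  also have "\<dots> = (\<integral>\<^sup>+x. indicator A x \<partial>lborel)" by (rule nn_integral_lborel_orthogonal[OF T]) simp
  finally show "emeasure (distr lborel borel T) A = emeasure lborel A" by simp
qed simp

lemma orthonormal_inner_sum:
  fixes B :: "'a::euclidean_space set"
  assumes "finite B" "pairwise orthogonal B" "\<And>b. b \<in> B \<Longrightarrow> norm b = 1" "a \<in> B"
  shows "(\<Sum>b\<in>B. c b *\<^sub>R b) \<bullet> a = c a"
proof -
  have "(\<Sum>b\<in>B. c b *\<^sub>R b) \<bullet> a = (\<Sum>b\<in>B. if b = a then c a else 0)"
    unfolding inner_sum_left
  proof (intro sum.cong refl)
    fix b assume "b \<in> B"
    then show "c b *\<^sub>R b \<bullet> a = (if b = a then c a else 0)"
      using assms by (auto simp: pairwise_def orthogonal_def dot_square_norm)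
  qed
  then show ?thesis using assms by simp
qed

lemma orthonormal_basis_of_UNIV_expand:
  fixes B :: "'a::euclidean_space set"
  assumes B: "orthonormal_basis_of UNIV B"
  shows "(\<Sum>b\<in>B. (x \<bullet> b) *\<^sub>R b) = x"
proof -
  have fin: "finite B" by (rule orthonormal_basis_of_finite_card[OF B])
  have o: "pairwise orthogonal B" "\<And>b. b \<in> B \<Longrightarrow> norm b = 1" and sp: "span B = UNIV"
    using B by (auto simp: orthonormal_basis_of_def)
  obtain c where c: "x = (\<Sum>b\<in>B. c b *\<^sub>R b)"
  proof -
    have "x \<in> span B" using sp by simp
    then show ?thesis using that unfolding span_finite[OF fin] by blast
  qed
  have "x \<bullet> b = c b" if "b \<in> B" for b unfolding c by (rule orthonormal_inner_sum[OF fin o that])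
  then have "(\<Sum>b\<in>B. (x \<bullet> b) *\<^sub>R b) = (\<Sum>b\<in>B. c b *\<^sub>R b)" by (intro sum.cong) auto
  from trans[OF this c[symmetric]] show ?thesis .
qed

lemma borel_measurable_PiM_linear_combination [measurable]:
  fixes B :: "'a::euclidean_space set"
  assumes "finite B"
  shows "(\<lambda>c. \<Sum>b\<in>B. c b *\<^sub>R b) \<in> borel_measurable (Pi\<^sub>M B (\<lambda>_. lborel))"
  by (intro borel_measurable_sum borel_measurable_scaleR) (auto intro: measurable_component_singleton)

text \<open>An orthogonal map \<open>T\<close> carries the standard basis to \<open>B\<close>, so a
  box in \<open>B\<close>-coordinates pulls back under \<open>T\<close> to a standard box with the
  same sides. Invariance of Lebesgue measure under \<open>T\<close> and uniqueness of product
  measures identify the law of the coordinates \<open>co\<close>, which the linear combination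
  inverts.\<close>

lemma distr_PiM_orthonormal_basis:
  fixes B :: "'a::euclidean_space set"
  assumes B: "orthonormal_basis_of UNIV B"
  shows "distr (Pi\<^sub>M B (\<lambda>_. lborel)) borel (\<lambda>c. \<Sum>b\<in>B. c b *\<^sub>R b) = lborel"
proof -
  interpret product_sigma_finite "\<lambda>_. lborel :: real measure" ..
  have fin: "finite B" by (rule orthonormal_basis_of_finite_card[OF B])
  have o: "pairwise orthogonal B" "\<And>b. b \<in> B \<Longrightarrow> norm b = 1"
    using B by (auto simp: orthonormal_basis_of_def)
  have "card B = card (Basis :: 'a set)"
    using orthonormal_basis_of_finite_card(2)[OF B] by simp
  then obtain f where f: "bij_betw f (Basis :: 'a set) B"
    using fin finite_Basis by (metis finite_same_card_bij)
  define T where "T = (\<lambda>x::'a. \<Sum>b\<in>Basis. (x \<bullet> b) *\<^sub>R f b)"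
  have Tf: "T x \<bullet> f b = x \<bullet> b" if "b \<in> Basis" for x b
  proof -
    have "T x = (\<Sum>a\<in>B. (x \<bullet> the_inv_into Basis f a) *\<^sub>R a)"
      unfolding T_def
      by (subst sum.reindex_bij_betw[OF f, symmetric])
         (use f in \<open>auto intro!: sum.cong simp: bij_betw_def the_inv_into_f_f\<close>)
    moreover have "f b \<in> B" using f that by (auto simp: bij_betw_def)
    ultimately have "T x \<bullet> f b = x \<bullet> the_inv_into Basis f (f b)"
      using orthonormal_inner_sum[OF fin o, of "f b" "\<lambda>a. x \<bullet> the_inv_into Basis f a"] by simp
    then show ?thesis using f that by (simp add: bij_betw_def the_inv_into_f_f)
  qed
  have T: "orthogonal_transformation T"
    unfolding orthogonal_transformation_def
  proof (intro conjI allI)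
    show "linear T" unfolding T_def
      by (intro linear_compose_sum ballI linear_compose_scale_right linearI)
        (auto simp: inner_add_left scaleR_add_left)
    fix v w
    have "T v \<bullet> T w = (\<Sum>b\<in>Basis. (w \<bullet> b) * (T v \<bullet> f b))"
      by (subst (2) T_def) (simp add: inner_sum_right)
    also have "\<dots> = v \<bullet> w" using Tf by (subst euclidean_inner) (simp add: mult.commute)
    finally show "T v \<bullet> T w = v \<bullet> w" .
  qed
  then have lT: "linear T" by (simp add: orthogonal_transformation_linear)
  then have [measurable]: "T \<in> borel_measurable borel"
    by (intro borel_measurable_continuous_onI linear_continuous_on linear_conv_bounded_linear[THEN iffD1])
  define co where "co = (\<lambda>x::'a. \<lambda>b\<in>B. x \<bullet> b)"
  have co[measurable]: "co \<in> measurable borel (Pi\<^sub>M B (\<lambda>_. lborel))"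
    unfolding co_def by (intro measurable_restrict) simp
  have co_PiM: "distr lborel (Pi\<^sub>M B (\<lambda>_. lborel)) co = Pi\<^sub>M B (\<lambda>_. lborel)"
  proof (rule PiM_eqI[OF fin])
    fix A :: "'a \<Rightarrow> real set" assume A: "\<And>i. i \<in> B \<Longrightarrow> A i \<in> sets lborel"
    have A': "A (f b) \<in> sets lborel" if "b \<in> Basis" for b
      using A[of "f b"] f that by (auto simp: bij_betw_def)
    define X where "X = {x::'a. \<forall>b\<in>Basis. x \<bullet> b \<in> A (f b)}"
    have X_eq: "X = T -` {y. \<forall>b\<in>B. y \<bullet> b \<in> A b}"
      using f Tf unfolding X_def bij_betw_def by auto
    have co_eq: "co -` (Pi\<^sub>E B A) = {y. \<forall>b\<in>B. y \<bullet> b \<in> A b}"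
      by (auto simp: co_def PiE_def Pi_def)
    have PE: "Pi\<^sub>E B A \<in> sets (Pi\<^sub>M B (\<lambda>_. lborel))" using A fin by (intro sets_PiM_I_finite) auto
    then have [measurable]: "{y. \<forall>b\<in>B. y \<bullet> b \<in> A b} \<in> sets borel"
      using measurable_sets[OF co PE] by (simp add: co_eq)
    have "emeasure (distr lborel (Pi\<^sub>M B (\<lambda>_. lborel)) co) (Pi\<^sub>E B A) = emeasure lborel {y. \<forall>b\<in>B. y \<bullet> b \<in> A b}"
      using PE by (simp add: emeasure_distr co_eq)
    also have "\<dots> = emeasure (distr lborel borel T) {y. \<forall>b\<in>B. y \<bullet> b \<in> A b}"
      by (simp add: lborel_distr_orthogonal[OF T])
    also have "\<dots> = emeasure lborel X" by (simp add: emeasure_distr X_eq)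
    also have "\<dots> = emeasure (Pi\<^sub>M Basis (\<lambda>_. lborel)) (Pi\<^sub>E Basis (\<lambda>b. A (f b)))"
    proof -
      have "X \<in> sets borel" using measurable_sets[of T borel borel "{y. \<forall>b\<in>B. y \<bullet> b \<in> A b}"] by (simp add: X_eq)
      then have "emeasure lborel X = emeasure (Pi\<^sub>M Basis (\<lambda>_. lborel))
          ((\<lambda>c. \<Sum>b\<in>Basis. c b *\<^sub>R b) -` X \<inter> space (Pi\<^sub>M Basis (\<lambda>_. lborel)))"
        by (subst lborel_eq) (simp add: emeasure_distr)
      also have "(\<lambda>c. \<Sum>b\<in>Basis. c b *\<^sub>R b) -` X \<inter> space (Pi\<^sub>M Basis (\<lambda>_. lborel)) = Pi\<^sub>E Basis (\<lambda>b. A (f b))"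
        by (auto simp: X_def space_PiM PiE_def Pi_def)
      finally show ?thesis .
    qed
    also have "\<dots> = (\<Prod>b\<in>Basis. emeasure lborel (A (f b)))"
      using A' by (intro emeasure_PiM) auto
    also have "\<dots> = (\<Prod>b\<in>B. emeasure lborel (A b))"
      by (rule prod.reindex_bij_betw[OF f])
    finally show "emeasure (distr lborel (Pi\<^sub>M B (\<lambda>_. lborel)) co) (Pi\<^sub>E B A) = (\<Prod>b\<in>B. emeasure lborel (A b))" .
  qed simp
  have "distr (Pi\<^sub>M B (\<lambda>_. lborel)) borel (\<lambda>c. \<Sum>b\<in>B. c b *\<^sub>R b)
     = distr (distr lborel (Pi\<^sub>M B (\<lambda>_. lborel)) co) borel (\<lambda>c. \<Sum>b\<in>B. c b *\<^sub>R b)"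
    by (simp add: co_PiM)
  also have "\<dots> = distr lborel borel ((\<lambda>c. \<Sum>b\<in>B. c b *\<^sub>R b) \<circ> co)"
    using fin by (intro distr_distr) measurable
  also have "((\<lambda>c. \<Sum>b\<in>B. c b *\<^sub>R b) \<circ> co) = (\<lambda>x. x)"
    using orthonormal_basis_of_UNIV_expand[OF B] by (auto simp: co_def fun_eq_iff cong: sum.cong)
  also have "distr lborel borel (\<lambda>x::'a. x) = lborel"
    using distr_id[of "lborel :: 'a measure"] by (simp add: distr_cong[of lborel lborel borel lborel])
  finally show ?thesis .
qed

text \<open>Both sides agree on boxes, one factor \<open>a\<close> per coordinate, and boxes
  determine a product measure. Restricting the scaled function to \<open>I\<close> keeps it in the
  extensional function space.\<close>

lemma emeasure_PiM_lborel_scale: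
  fixes I :: "'i set"
  assumes I: "finite I" and a: "a > 0" and X: "X \<in> sets (Pi\<^sub>M I (\<lambda>_. lborel :: real measure))"
  shows "emeasure (Pi\<^sub>M I (\<lambda>_. lborel)) X
    = ennreal (a ^ card I) * emeasure (Pi\<^sub>M I (\<lambda>_. lborel)) {c \<in> space (Pi\<^sub>M I (\<lambda>_. lborel)). (\<lambda>i\<in>I. a * c i) \<in> X}"
proof -
  interpret product_sigma_finite "\<lambda>_. lborel :: real measure" ..
  let ?P = "Pi\<^sub>M I (\<lambda>_. lborel :: real measure)"
  define S where "S = (\<lambda>c::'i \<Rightarrow> real. \<lambda>i\<in>I. a * c i)"
  have S[measurable]: "S \<in> measurable ?P ?P"
    unfolding S_def by (intro measurable_restrict) (auto intro: measurable_component_singleton)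
  have "scale_measure (ennreal (a ^ card I)) (distr ?P ?P S) = ?P"
  proof (rule PiM_eqI[OF I])
    fix A :: "'i \<Rightarrow> real set" assume A: "\<And>i. i \<in> I \<Longrightarrow> A i \<in> sets lborel"
    have PE: "Pi\<^sub>E I A \<in> sets ?P" using A I by (intro sets_PiM_I_finite) auto
    have "S -` (Pi\<^sub>E I A) \<inter> space ?P = Pi\<^sub>E I (\<lambda>i. (\<lambda>x. a * x) -` A i)"
      by (auto simp: S_def space_PiM PiE_def Pi_def)
    moreover have "(\<lambda>x. a * x) -` A i \<in> sets lborel" if "i \<in> I" for i
      using measurable_sets[of "\<lambda>x. a * x" borel borel "A i"] A[OF that] by simp
    ultimately have "emeasure (scale_measure (ennreal (a ^ card I)) (distr ?P ?P S)) (Pi\<^sub>E I A)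
        = ennreal (a ^ card I) * (\<Prod>i\<in>I. emeasure lborel ((\<lambda>x. a * x) -` A i))"
      using PE I by (simp add: emeasure_distr emeasure_PiM)
    also have "\<dots> = (\<Prod>i\<in>I. ennreal a * emeasure lborel ((\<lambda>x. a * x) -` A i))"
      using a by (simp add: prod.distrib ennreal_power)
    also have "\<dots> = (\<Prod>i\<in>I. emeasure lborel (A i))"
    proof (intro prod.cong refl)
      fix i assume i: "i \<in> I"
      have [measurable]: "A i \<in> sets borel" using A[OF i] by simp
      have "emeasure lborel (A i) = (\<integral>\<^sup>+x. indicator (A i) x \<partial>lborel)" by simp
      also have "\<dots> = ennreal \<bar>a\<bar> * (\<integral>\<^sup>+x. indicator (A i) (0 + a * x) \<partial>lborel)"
        using a by (intro nn_integral_real_affine) auto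
      also have "(\<lambda>x. indicator (A i) (0 + a * x)) = indicator ((\<lambda>x. a * x) -` A i)"
        by (auto simp: indicator_def fun_eq_iff)
      also have "(\<integral>\<^sup>+x. indicator ((\<lambda>x. a * x) -` A i) x \<partial>lborel) = emeasure lborel ((\<lambda>x. a * x) -` A i)"
        using measurable_sets[of "\<lambda>x. a * x" borel borel "A i"] by (intro nn_integral_indicator) simp
      finally show "ennreal a * emeasure lborel ((\<lambda>x. a * x) -` A i) = emeasure lborel (A i)" using a by simp
    qed
    finally show "emeasure (scale_measure (ennreal (a ^ card I)) (distr ?P ?P S)) (Pi\<^sub>E I A) = (\<Prod>i\<in>I. emeasure lborel (A i))" .
  qed simp
  then have "emeasure ?P X = ennreal (a ^ card I) * emeasure (distr ?P ?P S) X"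
    by (metis emeasure_scale_measure)
  also have "emeasure (distr ?P ?P S) X = emeasure ?P (S -` X \<inter> space ?P)"
    using X by (intro emeasure_distr) auto
  also have "S -` X \<inter> space ?P = {c \<in> space ?P. (\<lambda>i\<in>I. a * c i) \<in> X}"
    by (auto simp: S_def)
  finally show ?thesis .
qed

section \<open>The section volume as a Fourier integral\<close>

text \<open>The p-th power of the l_p quasi-norm, hence homogeneous of degree \<open>p\<close>: its
  sublevel set at r > 0 is the ball dilated by \<open>r powr (1 / p)\<close>.\<close>

definition lp_gauge :: "real \<Rightarrow> real^'n \<Rightarrow> real" where
  "lp_gauge p x = (\<Sum>i\<in>UNIV. \<bar>x $ i\<bar> powr p)"

lemma lp_gauge_nonneg: "lp_gauge p x \<ge> 0"
  by (simp add: lp_gauge_def sum_nonneg)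

lemma lp_gauge_scaleR: "a > 0 \<Longrightarrow> lp_gauge p (a *\<^sub>R x) = a powr p * lp_gauge p x"
  by (simp add: lp_gauge_def abs_mult powr_mult sum_distrib_left)

lemma lp_gauge_continuous: "p > 0 \<Longrightarrow> continuous_on S (lp_gauge p)"
  unfolding lp_gauge_def by (intro continuous_intros continuous_on_powr') auto

lemma lp_gauge_measurable [measurable]: "lp_gauge p \<in> borel_measurable borel"
  unfolding lp_gauge_def by measurable

text \<open>The Euclidean norm is at most the sum of the absolute coordinates, so some coordinate
  reaches the stated fraction of it, and a single summand suffices.\<close>

lemma lp_gauge_ge:
  fixes x :: "real^'n"
  assumes "p > 0"
  shows "(norm x / real CARD('n)) powr p \<le> lp_gauge p x"
proof -
  have "\<exists>i. norm x / real CARD('n) \<le> \<bar>x $ i\<bar>"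
  proof (rule ccontr)
    assume "\<not> ?thesis"
    then have "\<bar>x $ i\<bar> < norm x / real CARD('n)" for i by (simp add: not_le)
    then have "(\<Sum>i\<in>UNIV. \<bar>x $ i\<bar>) < (\<Sum>i\<in>(UNIV::'n set). norm x / real CARD('n))"
      by (intro sum_strict_mono) auto
    then show False using norm_le_l1_cart[of x] by simp
  qed
  then obtain i where "norm x / real CARD('n) \<le> \<bar>x $ i\<bar>" by blast
  then have "(norm x / real CARD('n)) powr p \<le> \<bar>x $ i\<bar> powr p"
    using assms by (intro powr_mono2) auto
  also have "\<dots> \<le> lp_gauge p x"
    unfolding lp_gauge_def by (intro member_le_sum) auto
  finally show ?thesis .
qed

lemma lp_ball_eq_lp_gauge: "lp_ball p = {x. lp_gauge p x \<le> 1}"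
  by (simp add: lp_ball_def lp_gauge_def)

lemma bij_betw_axis_Basis: "bij_betw (\<lambda>i. axis i 1) UNIV (Basis :: (real^'n) set)"
  by (auto simp: bij_betw_def inj_on_def axis_eq_axis Basis_vec_def)

text \<open>Gauge and phase are both sums over coordinates, so the integrand is a product of
  functions of one coordinate each and the integral factors.\<close>

lemma exp_lp_gauge_fourier:
  fixes y :: "real^'n"
  assumes p: "p > 0"
  shows "integrable lborel (\<lambda>x. complex_of_real (exp (- lp_gauge p x)) * iexp (- (x \<bullet> y)))"
    and "(LINT x|lborel. complex_of_real (exp (- lp_gauge p x)) * iexp (- (x \<bullet> y)))
      = complex_of_real (\<Prod>i\<in>UNIV. gamma_p p (y $ i))"
proof -
  interpret product_sigma_finite "\<lambda>_. lborel :: real measure" ..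
  define h where "h = (\<lambda>(b::real^'n) z. complex_of_real (exp (- (\<bar>z\<bar> powr p))) * iexp (- ((y \<bullet> b) * z)))"
  define H where "H = (\<lambda>x::real^'n. complex_of_real (exp (- lp_gauge p x)) * iexp (- (x \<bullet> y)))"
  have [measurable]: "H \<in> borel_measurable borel" unfolding H_def by measurable
  have h: "integrable lborel (h b)" for b
    unfolding h_def
    by (rule Bochner_Integration.integrable_bound[OF exp_minus_powr_integrable[OF p]]) (auto simp: norm_mult)
  have Hx: "H x = (\<Prod>b\<in>Basis. h b (x \<bullet> b))" for x
  proof -
    have "lp_gauge p x = (\<Sum>b\<in>Basis. \<bar>x \<bullet> b\<bar> powr p)"
      by (simp add: lp_gauge_def inner_axis sum.reindex_bij_betw[OF bij_betw_axis_Basis, symmetric])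
    moreover have "x \<bullet> y = (\<Sum>b\<in>Basis. (y \<bullet> b) * (x \<bullet> b))"
      by (subst euclidean_inner) (simp add: mult.commute)
    ultimately have "exp (- lp_gauge p x) = (\<Prod>b\<in>Basis. exp (- (\<bar>x \<bullet> b\<bar> powr p)))"
      "iexp (- (x \<bullet> y)) = (\<Prod>b\<in>Basis. iexp (- ((y \<bullet> b) * (x \<bullet> b))))"
      by (simp_all add: exp_sum[symmetric] sum_negf sum_distrib_left)
    then show ?thesis unfolding H_def h_def prod.distrib by (simp only: of_real_prod)
  qed
  have HP: "H (\<Sum>b\<in>Basis. c b *\<^sub>R b) = (\<Prod>b\<in>Basis. h b (c b))" for c
    unfolding Hx by (intro prod.cong refl) simp
  have "integrable (distr (Pi\<^sub>M Basis (\<lambda>_. lborel)) borel (\<lambda>c. \<Sum>b\<in>Basis. c b *\<^sub>R b)) H"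
    by (subst integrable_distr_eq) (auto simp: HP intro!: product_integrable_prod h)
  then show "integrable lborel (\<lambda>x. complex_of_real (exp (- lp_gauge p x)) * iexp (- (x \<bullet> y)))"
    unfolding H_def[symmetric] by (subst lborel_eq)
  have "(LINT x|lborel. H x) = (LINT x|distr (Pi\<^sub>M Basis (\<lambda>_. lborel)) borel (\<lambda>c. \<Sum>b\<in>Basis. c b *\<^sub>R b). H x)"
    by (subst lborel_eq) simp
  also have "\<dots> = (LINT c|Pi\<^sub>M Basis (\<lambda>_. lborel). (\<Prod>b\<in>Basis. h b (c b)))"
    by (subst integral_distr) (auto simp: HP)
  also have "\<dots> = (\<Prod>b\<in>Basis. LINT z|lborel. h b z)"
    by (rule product_integral_prod) (auto simp: h)
  also have "\<dots> = (\<Prod>b\<in>Basis. complex_of_real (gamma_p p (y \<bullet> b)))"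
    unfolding h_def gamma_p_fourier by simp
  also have "\<dots> = complex_of_real (\<Prod>i\<in>UNIV. gamma_p p (y $ i))"
    by (simp add: inner_axis prod.reindex_bij_betw[OF bij_betw_axis_Basis, symmetric])
  finally show "(LINT x|lborel. complex_of_real (exp (- lp_gauge p x)) * iexp (- (x \<bullet> y)))
      = complex_of_real (\<Prod>i\<in>UNIV. gamma_p p (y $ i))" by (simp add: H_def)
qed

section \<open>Integration over hyperplanes parallel to the section\<close>

text \<open>Fixing an orthonormal basis \<open>B\<close> of the hyperplane moves all integrals to
  the product measure \<open>P\<close> of coordinates. The locale is later interpreted at the basis
  selected in \<open>lborel_subspace\<close>.\<close>

locale hyperplane_section =
  fixes p :: real and \<xi> :: "real^'n" and B :: "(real^'n) set"
  assumes p: "0 < p" "p < 2" and \<xi>: "norm \<xi> = 1" and card: "CARD('n) > 1"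
    and B: "orthonormal_basis_of (orth_hyperplane \<xi>) B"
begin

abbreviation "P \<equiv> Pi\<^sub>M B (\<lambda>_. lborel :: real measure)"

definition S :: "(real^'n \<Rightarrow> real) \<Rightarrow> real^'n" where
  "S c = (\<Sum>b\<in>B. c b *\<^sub>R b)"

sublocale product_sigma_finite "\<lambda>_::real^'n. lborel :: real measure" ..

lemma fin: "finite B"
  by (rule orthonormal_basis_of_finite_card[OF B])

lemma card_B: "card B = CARD('n) - 1"
proof -
  have "\<xi> \<noteq> 0" using \<xi> by auto
  then show ?thesis
    using orthonormal_basis_of_finite_card(2)[OF B] dim_orth_hyperplane[of \<xi>] by simp
qed

lemma B_props: "pairwise orthogonal B" "\<And>b. b \<in> B \<Longrightarrow> norm b = 1" "\<And>b. b \<in> B \<Longrightarrow> b \<bullet> \<xi> = 0"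
  using B by (auto simp: orthonormal_basis_of_def orth_hyperplane_def)

lemma \<xi>_notin: "\<xi> \<notin> B"
  using B_props(3)[of \<xi>] \<xi> by auto

lemma S_inner_\<xi>: "S c \<bullet> \<xi> = 0"
  by (simp add: S_def inner_sum_left B_props(3))

lemma S_measurable [measurable]: "S \<in> borel_measurable P"
  unfolding S_def using fin by measurable

lemma S_scale: "S (\<lambda>i\<in>B. a * c i) = a *\<^sub>R S c"
  by (simp add: S_def scaleR_sum_right)

sublocale P: sigma_finite_measure P
  by (rule sigma_finite[OF fin])

sublocale pair: pair_sigma_finite "lborel :: real measure" P
  ..

lemma insert_basis: "orthonormal_basis_of UNIV (insert \<xi> B)"
  unfolding orthonormal_basis_of_def
proof (intro conjI)
  show po: "pairwise orthogonal (insert \<xi> B)"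
    using B_props by (auto simp: pairwise_insert orthogonal_def inner_commute)
  show n1: "\<forall>b\<in>insert \<xi> B. norm b = 1" using B_props(2) \<xi> by auto
  have "0 \<notin> insert \<xi> B" using n1 by auto
  then have ind: "independent (insert \<xi> B)" using po by (intro pairwise_orthogonal_independent)
  have "card (insert \<xi> B) = DIM(real^'n)"
    using fin \<xi>_notin card_B card by simp
  then have "UNIV \<subseteq> span (insert \<xi> B)"
    using ind by (intro card_ge_dim_independent) auto
  then show "span (insert \<xi> B) = UNIV" by auto
qed simp

text \<open>Splitting off the coordinate along \<open>\<xi>\<close> in the product over
  \<open>insert \<xi> B\<close> gives Fubini's theorem for slices orthogonal to
  \<open>\<xi>\<close>.\<close>

lemma distr_hyperplane_coords:
  "distr (lborel \<Otimes>\<^sub>M P) borel (\<lambda>(r, c). r *\<^sub>R \<xi> + S c) = lborel"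
proof (rule measure_eqI)
  fix A assume "A \<in> sets (distr (lborel \<Otimes>\<^sub>M P) borel (\<lambda>(r, c). r *\<^sub>R \<xi> + S c))"
  then have A[measurable]: "A \<in> sets borel" by simp
  let ?P = "Pi\<^sub>M (insert \<xi> B) (\<lambda>_. lborel :: real measure)"
  let ?S = "\<lambda>c. \<Sum>b\<in>insert \<xi> B. c b *\<^sub>R b"
  have fin': "finite (insert \<xi> B)" using fin by simp
  note [measurable] = borel_measurable_PiM_linear_combination[OF fin']
  have S': "?S (c(\<xi> := r)) = r *\<^sub>R \<xi> + S c" for c r
    unfolding S_def using fin \<xi>_notin
    by (subst sum.insert) (auto intro!: sum.cong)
  have "emeasure lborel A = emeasure (distr ?P borel ?S) A"
    by (simp only: distr_PiM_orthonormal_basis[OF insert_basis])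
  also have "\<dots> = (\<integral>\<^sup>+x. indicator A x \<partial>distr ?P borel ?S)" by simp
  also have "\<dots> = (\<integral>\<^sup>+c. indicator A (?S c) \<partial>?P)"
    by (intro nn_integral_distr) measurable
  also have "\<dots> = (\<integral>\<^sup>+r. (\<integral>\<^sup>+c. indicator A (?S (c(\<xi> := r))) \<partial>P) \<partial>lborel)"
    using fin \<xi>_notin by (intro product_nn_integral_insert_rev) measurable
  also have "\<dots> = (\<integral>\<^sup>+r. (\<integral>\<^sup>+c. indicator A (r *\<^sub>R \<xi> + S c) \<partial>P) \<partial>lborel)"
    by (simp only: S')
  also have "\<dots> = (\<integral>\<^sup>+z. indicator A (case z of (r, c) \<Rightarrow> r *\<^sub>R \<xi> + S c) \<partial>(lborel \<Otimes>\<^sub>M P))"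
    by (subst P.nn_integral_fst[symmetric]) auto
  also have "\<dots> = (\<integral>\<^sup>+x. indicator A x \<partial>distr (lborel \<Otimes>\<^sub>M P) borel (\<lambda>(r, c). r *\<^sub>R \<xi> + S c))"
    by (intro nn_integral_distr[symmetric]) measurable
  also have "\<dots> = emeasure (distr (lborel \<Otimes>\<^sub>M P) borel (\<lambda>(r, c). r *\<^sub>R \<xi> + S c)) A"
    by simp
  finally show "emeasure (distr (lborel \<Otimes>\<^sub>M P) borel (\<lambda>(r, c). r *\<^sub>R \<xi> + S c)) A = emeasure lborel A" ..
qed simp

text \<open>The parallel section function: since \<open>\<xi>\<close> is a unit vector,
  \<open>r\<close> is the signed distance of the slice from the origin.\<close>

definition A :: "real \<Rightarrow> real" where
  "A r = (LINT c|P. exp (- lp_gauge p (r *\<^sub>R \<xi> + S c)))"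

text \<open>The power of the dimension comes from \<open>lp_gauge_ge\<close>, and the factor
  \<open>card B\<close> from adding up the bounds for the single coordinates.\<close>

definition \<kappa> :: real where
  "\<kappa> = 1 / (real (card B) * real CARD('n) powr p)"

lemma card_B_pos: "card B > 0"
  using card_B card by simp

lemma \<kappa>_pos: "\<kappa> > 0"
  using card_B_pos by (simp add: \<kappa>_def)

text \<open>Orthogonality gives \<open>norm (r *\<^sub>R \<xi> + S c) \<ge> \<bar>c b\<bar>\<close> uniformly in \<open>r\<close>, hence one dominating function for
  all parallel sections.\<close>

lemma lp_gauge_section_ge:
  "\<kappa> * (\<Sum>b\<in>B. \<bar>c b\<bar> powr p) \<le> lp_gauge p (r *\<^sub>R \<xi> + S c)"
proof -
  let ?x = "r *\<^sub>R \<xi> + S c" and ?n = "real CARD('n)"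
  have "\<bar>c b\<bar> powr p \<le> ?n powr p * lp_gauge p ?x" if b: "b \<in> B" for b
  proof -
    have "?x \<bullet> b = c b"
      using B_props(3)[OF b] orthonormal_inner_sum[OF fin B_props(1,2) b, of c]
      by (simp add: inner_add_left S_def inner_commute[of \<xi>])
    then have "\<bar>c b\<bar> \<le> norm ?x"
      using Cauchy_Schwarz_ineq2[of ?x b] B_props(2)[OF b] by simp
    then have "(\<bar>c b\<bar> / ?n) powr p \<le> (norm ?x / ?n) powr p"
      using p by (intro powr_mono2 divide_right_mono) auto
    also have "\<dots> \<le> lp_gauge p ?x" using p by (intro lp_gauge_ge) auto
    finally show ?thesis by (simp add: powr_divide field_simps)
  qed
  then have "(\<Sum>b\<in>B. \<bar>c b\<bar> powr p) \<le> (\<Sum>b\<in>B. ?n powr p * lp_gauge p ?x)" by (intro sum_mono)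
  also have "\<dots> = real (card B) * (?n powr p * lp_gauge p ?x)" by simp
  finally show ?thesis using card_B_pos unfolding \<kappa>_def by (simp add: field_simps)
qed

text \<open>The majorant common to all slices; its product form reduces integrability to one
  dimension.\<close>

definition G :: "(real^'n \<Rightarrow> real) \<Rightarrow> real" where
  "G c = (\<Prod>b\<in>B. exp (- (\<kappa> * \<bar>c b\<bar> powr p)))"

lemma G_integrable: "integrable P G"
  unfolding G_def by (intro product_integrable_prod fin exp_minus_abs_powr_integral(1) p \<kappa>_pos)

lemma section_le_G: "exp (- lp_gauge p (r *\<^sub>R \<xi> + S c)) \<le> G c"
  unfolding G_def exp_sum[OF fin, symmetric] using lp_gauge_section_ge[of c r]
  by (simp add: sum_negf sum_distrib_left)

lemma section_measurable [measurable]: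
  "(\<lambda>c. exp (- lp_gauge p (r *\<^sub>R \<xi> + S c))) \<in> borel_measurable P"
  by measurable

lemma section_integrable: "integrable P (\<lambda>c. exp (- lp_gauge p (r *\<^sub>R \<xi> + S c)))"
proof (rule Bochner_Integration.integrable_bound[OF G_integrable section_measurable])
  show "AE c in P. norm (exp (- lp_gauge p (r *\<^sub>R \<xi> + S c))) \<le> norm (G c)"
    using order.trans[OF section_le_G abs_ge_self] by simp
qed

lemma A_nonneg: "A r \<ge> 0"
  unfolding A_def by (intro Bochner_Integration.integral_nonneg) simp

lemma A_bound: "\<bar>A r\<bar> \<le> (LINT c|P. G c)"
proof -
  have "A r \<le> (LINT c|P. G c)"
    unfolding A_def by (intro integral_mono section_integrable G_integrable section_le_G)
  then show ?thesis using A_nonneg[of r] by simp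
qed

lemma A_continuous: "continuous_on UNIV A"
proof (rule continuous_on_sequentiallyI)
  fix X and r :: real assume X: "X \<longlonglongrightarrow> r"
  show "(\<lambda>k. A (X k)) \<longlonglongrightarrow> A r"
    unfolding A_def
  proof (rule integral_dominated_convergence[OF _ _ G_integrable])
    have "(\<lambda>k. exp (- lp_gauge p (X k *\<^sub>R \<xi> + S c))) \<longlonglongrightarrow> exp (- lp_gauge p (r *\<^sub>R \<xi> + S c))" for c
    proof -
      have "isCont (lp_gauge p :: real^'n \<Rightarrow> real) (r *\<^sub>R \<xi> + S c)"
        using lp_gauge_continuous[OF p(1), of "UNIV :: (real^'n) set"] by (simp add: continuous_on_eq_continuous_at)
      moreover have "(\<lambda>k. X k *\<^sub>R \<xi> + S c) \<longlonglongrightarrow> r *\<^sub>R \<xi> + S c" by (intro tendsto_intros X)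
      ultimately have "(\<lambda>k. lp_gauge p (X k *\<^sub>R \<xi> + S c)) \<longlonglongrightarrow> lp_gauge p (r *\<^sub>R \<xi> + S c)"
        by (rule isCont_tendsto_compose)
      then show ?thesis by (intro tendsto_intros)
    qed
    then show "AE c in P. (\<lambda>k. exp (- lp_gauge p (X k *\<^sub>R \<xi> + S c))) \<longlonglongrightarrow> exp (- lp_gauge p (r *\<^sub>R \<xi> + S c))"
      by simp
    show "AE c in P. norm (exp (- lp_gauge p (X k *\<^sub>R \<xi> + S c))) \<le> G c" for k
      using section_le_G by simp
  qed measurable
qed

lemma integrable_hyperplane_coords:
  fixes h :: "real^'n \<Rightarrow> complex"
  assumes "integrable lborel h"
  shows "integrable (lborel \<Otimes>\<^sub>M P) (\<lambda>(r, c). h (r *\<^sub>R \<xi> + S c))"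
proof -
  note [measurable] = borel_measurable_integrable[OF assms]
  have "integrable (distr (lborel \<Otimes>\<^sub>M P) borel (\<lambda>(r, c). r *\<^sub>R \<xi> + S c)) h"
    using assms by (simp only: distr_hyperplane_coords)
  then have "integrable (lborel \<Otimes>\<^sub>M P) (\<lambda>z. h (case z of (r, c) \<Rightarrow> r *\<^sub>R \<xi> + S c))"
    by (subst (asm) integrable_distr_eq) measurable
  then show ?thesis by (simp add: case_prod_unfold)
qed

lemma integral_hyperplane_coords:
  fixes h :: "real^'n \<Rightarrow> complex"
  assumes "integrable lborel h"
  shows "(LINT x|lborel. h x) = (LINT r|lborel. LINT c|P. h (r *\<^sub>R \<xi> + S c))"
proof -
  note [measurable] = borel_measurable_integrable[OF assms]
  have "(LINT x|lborel. h x) = (LINT x|distr (lborel \<Otimes>\<^sub>M P) borel (\<lambda>(r, c). r *\<^sub>R \<xi> + S c). h x)"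
    by (simp only: distr_hyperplane_coords)
  also have "\<dots> = (LINT z|(lborel \<Otimes>\<^sub>M P). h (case z of (r, c) \<Rightarrow> r *\<^sub>R \<xi> + S c))"
    by (intro integral_distr) measurable
  also have "\<dots> = (LINT z|(lborel \<Otimes>\<^sub>M P). (\<lambda>(r, c). h (r *\<^sub>R \<xi> + S c)) z)"
    by (simp add: case_prod_unfold)
  also have "\<dots> = (LINT r|lborel. LINT c|P. h (r *\<^sub>R \<xi> + S c))"
    using pair.integral_fst[OF integrable_hyperplane_coords[OF assms]] by simp
  finally show ?thesis .
qed

text \<open>At frequency \<open>t *\<^sub>R \<xi>\<close> the phase is constant on each slice,
  because \<open>(r *\<^sub>R \<xi> + S c) \<bullet> \<xi> = r\<close>. Slicing therefore turns the
  n-dimensional transform into that of \<open>A\<close>; the frequency 0 gives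
  integrability.\<close>

lemma A_fourier:
  shows "integrable lborel A"
    and "complex_of_real (\<Prod>i\<in>UNIV. gamma_p p (t * \<xi> $ i))
      = (LINT r|lborel. complex_of_real (A r) * iexp (- (t * r)))"
proof -
  define h where "h = (\<lambda>t x. complex_of_real (exp (- lp_gauge p x)) * iexp (- (x \<bullet> (t *\<^sub>R \<xi>))))"
  have h: "integrable lborel (h t)" for t
    unfolding h_def by (rule exp_lp_gauge_fourier(1)[OF p(1)])
  have sec: "(LINT c|P. h t (r *\<^sub>R \<xi> + S c)) = complex_of_real (A r) * iexp (- (t * r))" for r t
  proof -
    have "(r *\<^sub>R \<xi> + S c) \<bullet> \<xi> = r" for c
      using \<xi> by (simp add: inner_add_left S_inner_\<xi> dot_square_norm)
    then have "(LINT c|P. h t (r *\<^sub>R \<xi> + S c)) = (LINT c|P. complex_of_real (exp (- lp_gauge p (r *\<^sub>R \<xi> + S c))) * iexp (- (t * r)))"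
      by (simp add: h_def)
    also have "\<dots> = (LINT c|P. complex_of_real (exp (- lp_gauge p (r *\<^sub>R \<xi> + S c)))) * iexp (- (t * r))"
      by (rule integral_mult_left_zero)
    also have "(LINT c|P. complex_of_real (exp (- lp_gauge p (r *\<^sub>R \<xi> + S c)))) = complex_of_real (A r)"
      unfolding A_def by (rule integral_complex_of_real)
    finally show ?thesis .
  qed
  have "integrable lborel (\<lambda>r. LINT c|P. h 0 (r *\<^sub>R \<xi> + S c))"
    using pair.integrable_fst[OF integrable_hyperplane_coords[OF h]] by simp
  then have "integrable lborel (\<lambda>r. complex_of_real (A r))" by (simp add: sec)
  then show "integrable lborel A" by (simp only: complex_of_real_integrable_eq)
  have "complex_of_real (\<Prod>i\<in>UNIV. gamma_p p (t * \<xi> $ i)) = (LINT x|lborel. h t x)"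
    unfolding h_def by (subst exp_lp_gauge_fourier(2)[OF p(1)]) simp
  then show "complex_of_real (\<Prod>i\<in>UNIV. gamma_p p (t * \<xi> $ i))
      = (LINT r|lborel. complex_of_real (A r) * iexp (- (t * r)))"
    by (simp add: integral_hyperplane_coords[OF h] sec)
qed

lemma prod_gamma_p_integral:
  shows "integrable lborel (\<lambda>t. \<Prod>i\<in>UNIV. gamma_p p (t * \<xi> $ i))"
    and "(LINT t|lborel. (\<Prod>i\<in>UNIV. gamma_p p (t * \<xi> $ i))) = 2 * pi * A 0"
proof -
  have c: "isCont A 0" using A_continuous by (simp add: continuous_on_eq_continuous_at)
  have nn: "(\<Prod>i\<in>UNIV. gamma_p p (t * \<xi> $ i)) \<ge> 0" for t
    by (intro prod_nonneg ballI gamma_p_exp_convex(2)[OF p])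
  have m: "(\<lambda>t. \<Prod>i\<in>UNIV. gamma_p p (t * \<xi> $ i)) \<in> borel_measurable borel"
    by (intro borel_measurable_prod measurable_compose[OF _ gamma_p_measurable[OF p(1)]]) measurable
  note * = fourier_nonneg_integrable[OF A_fourier(1) A_bound c A_fourier(2) nn m]
  show "integrable lborel (\<lambda>t. \<Prod>i\<in>UNIV. gamma_p p (t * \<xi> $ i))"
    and "(LINT t|lborel. (\<Prod>i\<in>UNIV. gamma_p p (t * \<xi> $ i))) = 2 * pi * A 0" by (rule *)+
qed

text \<open>Dilating the coordinates by a = \<open>r powr (1 / p)\<close> multiplies the gauge by r
  and the measure by \<open>a ^ card B\<close>.\<close>

lemma section_emeasure_scale:
  assumes r: "r > 0"
  shows "emeasure P {c \<in> space P. lp_gauge p (S c) \<le> r}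
    = ennreal (r powr (real (card B) / p)) * emeasure P {c \<in> space P. lp_gauge p (S c) \<le> 1}"
proof -
  define a where "a = r powr (1 / p)"
  have a: "a > 0" using r by (simp add: a_def)
  have ap: "a powr p = r" using r p by (simp add: a_def powr_powr)
  have am: "a ^ card B = r powr (real (card B) / p)"
    using r by (simp add: a_def powr_realpow[symmetric] powr_powr)
  have "{c \<in> space P. (\<lambda>i\<in>B. a * c i) \<in> {c \<in> space P. lp_gauge p (S c) \<le> r}} = {c \<in> space P. lp_gauge p (S c) \<le> 1}"
    using r a by (auto simp: S_scale lp_gauge_scaleR ap space_PiM)
  then show ?thesis
    using emeasure_PiM_lborel_scale[OF fin a, of "{c \<in> space P. lp_gauge p (S c) \<le> r}"] by (simp add: am)
qed

lemma A_0_conv_measure: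
  "A 0 = Gamma (1 + real (card B) / p) * measure P {c \<in> space P. lp_gauge p (S c) \<le> 1}"
proof -
  let ?V = "emeasure P {c \<in> space P. lp_gauge p (S c) \<le> 1}" and ?\<Gamma> = "Gamma (1 + real (card B) / p)"
  have d: "real (card B) / p > 0" using card_B_pos p by simp
  then have \<Gamma>: "?\<Gamma> > 0" by (intro Gamma_real_pos) auto
  have "ennreal (A 0) = (\<integral>\<^sup>+c. ennreal (exp (- lp_gauge p (S c))) \<partial>P)"
    unfolding A_def using section_integrable[of 0] by (subst nn_integral_eq_integral) auto
  also have "\<dots> = ennreal ?\<Gamma> * ?V"
    using d by (intro nn_integral_exp_minus_homogeneous P.sigma_finite_measure_axioms section_emeasure_scale)
      (auto simp: lp_gauge_nonneg)
  finally have eq: "ennreal (A 0) = ennreal ?\<Gamma> * ?V" .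
  \<comment> \<open>Boundedness of the section is never shown: an infinite volume would make the
    finite number \<open>A 0\<close> infinite, as the Gamma factor is positive.\<close>
  then have "?V \<noteq> \<infinity>" using \<Gamma> by (auto simp: ennreal_mult_top)
  then have "?V = ennreal (measure P {c \<in> space P. lp_gauge p (S c) \<le> 1})"
    by (intro emeasure_eq_ennreal_measure) (auto simp: top_ennreal_def)
  with eq have "ennreal (A 0) = ennreal (?\<Gamma> * measure P {c \<in> space P. lp_gauge p (S c) \<le> 1})"
    using \<Gamma> by (simp add: ennreal_mult)
  then show ?thesis using A_nonneg[of 0] \<Gamma> by (simp add: ennreal_inj)
qed

end

section \<open>The volume formula\<close>

lemma integral_even_half_line:
  fixes f :: "real \<Rightarrow> real"
  assumes f: "integrable lborel f" and even: "\<And>t. f (- t) = f t"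
  shows "(LBINT t. f t) = 2 * (LBINT t:{0..}. f t)"
proof -
  note [measurable] = borel_measurable_integrable[OF f]
  have i: "integrable lborel (\<lambda>t. indicator A t *\<^sub>R f t)" if "A \<in> sets borel" for A
    using that by (intro integrable_mult_indicator f) simp
  have "(LBINT t. indicator {..<0} t *\<^sub>R f t) = \<bar>-1\<bar> *\<^sub>R (LBINT t. indicator {..<0} (0 + (-1) * t) *\<^sub>R f (0 + (-1) * t))"
    by (rule lborel_integral_real_affine) simp
  also have "\<dots> = (LBINT t. indicator {0<..} t *\<^sub>R f t)"
    by (simp add: even indicator_def)
  also have "\<dots> = (LBINT t. indicator {0..} t *\<^sub>R f t)"
  proof (rule integral_cong_AE)
    show "AE t in lborel. indicator {0<..} t *\<^sub>R f t = indicator {0..} t *\<^sub>R f t"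
      using AE_lborel_singleton[of "0::real"] by eventually_elim (simp add: indicator_def)
  qed measurable
  finally have neg: "(LBINT t. indicator {..<0} t *\<^sub>R f t) = (LBINT t. indicator {0..} t *\<^sub>R f t)" .
  have "(LBINT t. f t) = (LBINT t. indicator {..<0} t *\<^sub>R f t + indicator {0..} t *\<^sub>R f t)"
    by (intro Bochner_Integration.integral_cong refl) (auto simp: indicator_def)
  also have "\<dots> = (LBINT t. indicator {..<0} t *\<^sub>R f t) + (LBINT t. indicator {0..} t *\<^sub>R f t)"
    by (intro Bochner_Integration.integral_add i) auto
  finally show ?thesis by (simp only: neg set_lebesgue_integral_def mult_2)
qed

lemma central_section_volume_eq:
  fixes \<xi> :: "real^'n"
  assumes p: "0 < p" "p < 2" and \<xi>: "norm \<xi> = 1" and card: "CARD('n) > 1"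
  defines "m \<equiv> real CARD('n) - 1"
  shows "integrable lborel (\<lambda>t. \<Prod>i\<in>UNIV. gamma_p p (t * \<xi> $ i))"
    and "central_section_volume p \<xi> = p / (pi * m * Gamma (m / p)) * (LBINT t:{0..}. (\<Prod>i\<in>UNIV. gamma_p p (t * \<xi> $ i)))"
proof -
  \<comment> \<open>This has to be the very basis selected inside \<open>lborel_subspace\<close>, so
    that the volume unfolds to a measure in the coordinates of the locale.\<close>
  define B where "B = (SOME B. orthonormal_basis_of (orth_hyperplane \<xi>) B)"
  have "subspace (orth_hyperplane \<xi>)"
    unfolding orth_hyperplane_def by (simp add: subspace_def inner_add_left)
  then have B: "orthonormal_basis_of (orth_hyperplane \<xi>) B"
    unfolding B_def by (rule someI_ex[OF orthonormal_basis_of_exists])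
  interpret hyperplane_section p \<xi> B by unfold_locales (use p \<xi> card B in auto)
  let ?F = "\<lambda>t. \<Prod>i\<in>UNIV. gamma_p p (t * \<xi> $ i)"
  show int: "integrable lborel ?F" by (rule prod_gamma_p_integral(1))
  have m: "real (card B) = m" using card by (simp add: card_B m_def)
  have m0: "m > 0" using card by (simp add: m_def)
  have [measurable]: "orth_hyperplane \<xi> \<in> sets borel" "lp_ball p \<in> sets (borel :: (real^'n) measure)"
    unfolding orth_hyperplane_def lp_ball_eq_lp_gauge by measurable
  have "central_section_volume p \<xi> = measure (distr P borel S) (lp_ball p \<inter> orth_hyperplane \<xi>)"
    by (simp add: central_section_volume_def lborel_subspace_def Let_def B_def[symmetric] S_def[abs_def])
  also have "\<dots> = measure P (S -` (lp_ball p \<inter> orth_hyperplane \<xi>) \<inter> space P)"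
    by (intro measure_distr) measurable
  also have "S -` (lp_ball p \<inter> orth_hyperplane \<xi>) \<inter> space P = {c \<in> space P. lp_gauge p (S c) \<le> 1}"
    by (auto simp: lp_ball_eq_lp_gauge orth_hyperplane_def S_inner_\<xi>)
  finally have V: "A 0 = Gamma (1 + m / p) * central_section_volume p \<xi>"
    using A_0_conv_measure by (simp add: m)
  have "(LBINT t. ?F t) = 2 * (LBINT t:{0..}. ?F t)"
    using int by (rule integral_even_half_line) (simp add: gamma_p_minus[OF p(1)])
  then have "(LBINT t:{0..}. ?F t) = pi * (Gamma (1 + m / p) * central_section_volume p \<xi>)"
    using prod_gamma_p_integral(2) V by simp
  moreover have "Gamma (1 + m / p) = m / p * Gamma (m / p)"
  proof -
    have "m / p > 0" using m0 p by simp
    then have "m / p \<notin> \<int>\<^sub>\<le>\<^sub>0" by (auto dest: nonpos_Ints_nonpos)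
    then show ?thesis using Gamma_plus1[of "m / p"] by (simp add: add.commute)
  qed
  moreover have "Gamma (m / p) \<noteq> 0"
    by (rule less_imp_neq[OF Gamma_real_pos, symmetric]) (use m0 p in simp)
  ultimately show "central_section_volume p \<xi> = p / (pi * m * Gamma (m / p)) * (LBINT t:{0..}. ?F t)"
    using m0 p by simp
qed

section \<open>Jensen's inequality and its equality cases\<close>

text \<open>The tilt \<open>l\<close> is chosen so that \<open>exp (l * x) * g x\<close> takes equal
  values at the two end points. Convexity bounds it in between by that common value, and the
  logarithm of this bound is the claim.\<close>

lemma ln_convex_onI:
  fixes g :: "real \<Rightarrow> real"
  assumes pos: "\<And>x. x \<in> S \<Longrightarrow> g x > 0"
    and conv: "\<And>l. convex_on S (\<lambda>x. exp (l * x) * g x)"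
  shows "convex_on S (\<lambda>x. ln (g x))"
proof (rule convex_onI)
  show S: "convex S" using conv[of 0] convex_on_imp_convex by blast
  fix t x y :: real assume t: "0 < t" "t < 1" and xy: "x \<in> S" "y \<in> S"
  let ?z = "(1 - t) *\<^sub>R x + t *\<^sub>R y"
  show "ln (g ?z) \<le> (1 - t) * ln (g x) + t * ln (g y)"
  proof (cases "x = y")
    case True
    then show ?thesis by (simp add: algebra_simps)
  next
    case False
    have z: "?z \<in> S" using S xy t by (simp add: convex_alt)
    define l where "l = (ln (g x) - ln (g y)) / (y - x)"
    have "l * (y - x) = ln (g x) - ln (g y)" using False by (simp add: l_def)
    then have l: "l * y + ln (g y) = l * x + ln (g x)" by (simp add: algebra_simps)
    have E: "exp (l * u) * g u = exp (l * u + ln (g u))" if "u \<in> S" for u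
      using pos[OF that] by (simp add: exp_add)
    have "exp (l * ?z) * g ?z \<le> (1 - t) * (exp (l * x) * g x) + t * (exp (l * y) * g y)"
      using convex_onD[OF conv[of l], of t x y] t xy by simp
    also have "\<dots> = exp (l * x + ln (g x))"
      unfolding E[OF xy(1)] E[OF xy(2)] l by (simp add: algebra_simps)
    finally have "l * ?z + ln (g ?z) \<le> l * x + ln (g x)" unfolding E[OF z] by simp
    also have "\<dots> = (1 - t) * (l * x + ln (g x)) + t * (l * y + ln (g y))"
      unfolding l by (simp add: algebra_simps)
    finally show ?thesis by (simp add: algebra_simps)
  qed
qed

lemma gamma_p_0_pos: "p > 0 \<Longrightarrow> gamma_p p 0 > 0"
proof -
  assume p: "p > 0"
  then have "1 + 1 / p > 0" by (simp add: add_pos_pos)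
  then show ?thesis using Gamma_real_pos gamma_p_0[OF p] by simp
qed

text \<open>Suppose \<open>t\<close> is a zero. The chord of the tilted function from 0 to
  \<open>t\<^sup>2\<close> does not depend on the tilt, which is 1 at one end and multiplies 0 at
  the other. A positive value in between would exceed the chord under a large tilt, so the zeros
  extend down to 0, against continuity and \<open>gamma_p p 0 > 0\<close>.\<close>

lemma gamma_p_pos:
  assumes p: "0 < p" "p < 2"
  shows "gamma_p p t > 0"
proof (rule ccontr)
  assume "\<not> gamma_p p t > 0"
  then have t0: "gamma_p p \<bar>t\<bar> = 0"
    using gamma_p_exp_convex(2)[OF p, of t] gamma_p_abs[OF p(1), of t] by simp
  then have t: "t \<noteq> 0" using gamma_p_0_pos[OF p(1)] by auto
  have zero: "gamma_p p (sqrt s) = 0" if s: "0 < s" "s < t\<^sup>2" for s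
  proof (rule ccontr)
    assume "gamma_p p (sqrt s) \<noteq> 0"
    then have gs: "gamma_p p (sqrt s) > 0" using gamma_p_exp_convex(2)[OF p, of "sqrt s"] by simp
    let ?\<theta> = "s / t\<^sup>2"
    \<comment> \<open>This tilt makes \<open>exp (l * s) * gamma_p p (sqrt s)\<close> equal to twice
      \<open>gamma_p p 0\<close>.\<close>
    define l where "l = - ln (gamma_p p (sqrt s) / (2 * gamma_p p 0)) / s"
    have \<theta>: "0 \<le> ?\<theta>" "?\<theta> \<le> 1" "?\<theta> * t\<^sup>2 = s" using s t by auto
    have "exp (l * s) * gamma_p p (sqrt s) \<le> (1 - ?\<theta>) * gamma_p p 0"
      using convex_onD[OF gamma_p_exp_convex(1)[OF p, of l], of ?\<theta> 0 "t\<^sup>2"] \<theta> t0 by simp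
    also have "\<dots> \<le> 1 * gamma_p p 0"
      using \<theta> gamma_p_0_pos[OF p(1)] by (intro mult_right_mono) auto
    finally have "exp (l * s) * gamma_p p (sqrt s) \<le> gamma_p p 0" by simp
    moreover have "exp (l * s) * gamma_p p (sqrt s) = 2 * gamma_p p 0"
      using s gs gamma_p_0_pos[OF p(1)] by (simp add: l_def exp_minus)
    ultimately show False using gamma_p_0_pos[OF p(1)] by simp
  qed
  \<comment> \<open>Starting with the factor 1/2 keeps every point strictly between 0 and
    \<bar>t\<bar>.\<close>
  have "(\<lambda>k. \<bar>t\<bar> * inverse (real (Suc (Suc k)))) \<longlonglongrightarrow> \<bar>t\<bar> * 0"
    by (intro tendsto_intros LIMSEQ_Suc[OF LIMSEQ_inverse_real_of_nat])
  then have "(\<lambda>k. gamma_p p (\<bar>t\<bar> * inverse (real (Suc (Suc k))))) \<longlonglongrightarrow> gamma_p p 0"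
    by (intro gamma_p_tendsto p(1)) simp
  moreover have "gamma_p p (\<bar>t\<bar> * inverse (real (Suc (Suc k)))) = 0" for k
  proof -
    let ?u = "\<bar>t\<bar> * inverse (real (Suc (Suc k)))"
    have "inverse (real (Suc (Suc k))) < 1" by (simp add: field_simps)
    then have "?u < \<bar>t\<bar> * 1" using t by (intro mult_strict_left_mono) auto
    then have u: "0 < ?u" "?u < \<bar>t\<bar>" using t by auto
    then have "?u\<^sup>2 < \<bar>t\<bar>\<^sup>2" by (intro power_strict_mono) auto
    then have "gamma_p p (sqrt (?u\<^sup>2)) = 0" using u(1) by (intro zero) auto
    then show ?thesis using u(1) by simp
  qed
  ultimately have "gamma_p p 0 = 0" by (simp add: LIMSEQ_const_iff)
  then show False using gamma_p_0_pos[OF p(1)] by simp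
qed

definition log_gamma_sqrt :: "real \<Rightarrow> real \<Rightarrow> real" where
  "log_gamma_sqrt p q = ln (gamma_p p (sqrt q))"

lemma gamma_p_eq_exp:
  assumes "0 < p" "p < 2"
  shows "gamma_p p t = exp (log_gamma_sqrt p (t\<^sup>2))"
  using gamma_p_pos[OF assms] by (simp add: log_gamma_sqrt_def gamma_p_abs[OF assms(1)])

lemma log_gamma_sqrt_convex:
  assumes "0 < p" "p < 2"
  shows "convex_on {0..} (log_gamma_sqrt p)"
  unfolding log_gamma_sqrt_def[abs_def]
  by (intro ln_convex_onI gamma_p_pos gamma_p_exp_convex assms)

lemma log_gamma_sqrt_continuous:
  assumes "0 < p" "p < 2"
  shows "continuous_on S (log_gamma_sqrt p)"
  unfolding log_gamma_sqrt_def[abs_def]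
  using gamma_p_pos[OF assms]
  by (intro continuous_intros continuous_on_compose2[OF gamma_p_continuous[OF assms(1), of UNIV]])
    (auto simp: less_imp_neq[symmetric])

section \<open>Equality cases and affine pieces\<close>

text \<open>A supporting line at the interior point \<open>m\<close>, averaged over the
  \<open>x i\<close>, returns \<open>h m\<close>. Equality thus makes a sum of nonnegative gaps with
  positive weights vanish, so every \<open>x i\<close> lies on the line.\<close>

lemma convex_jensen_equality:
  fixes h :: "real \<Rightarrow> real"
  assumes h: "convex_on {0..} h" and I: "finite I"
    and v: "\<And>i. i \<in> I \<Longrightarrow> v i > 0" "(\<Sum>i\<in>I. v i) = 1"
    and x: "\<And>i. i \<in> I \<Longrightarrow> x i \<ge> 0"
    and m: "m = (\<Sum>i\<in>I. v i * x i)" "m > 0"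
    and eq: "h m = (\<Sum>i\<in>I. v i * h (x i))"
  obtains d where "\<And>y. y \<ge> 0 \<Longrightarrow> h m + d * (y - m) \<le> h y"
    and "\<And>i. i \<in> I \<Longrightarrow> h (x i) = h m + d * (x i - m)"
proof -
  obtain d where d: "\<And>y. y \<ge> 0 \<Longrightarrow> h m + d * (y - m) \<le> h y"
    using convex_le_Inf_differential[OF h, of m] m(2) by (auto simp: interior_real_atLeast)
  have "(\<Sum>i\<in>I. v i * (h (x i) - (h m + d * (x i - m))))
      = (\<Sum>i\<in>I. v i * h (x i)) - (h m - d * m) * (\<Sum>i\<in>I. v i) - d * (\<Sum>i\<in>I. v i * x i)"
    by (simp add: algebra_simps sum.distrib sum_subtractf sum_distrib_left)
  also have "\<dots> = 0" using v(2) m(1) eq by simp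
  finally have sum0: "(\<Sum>i\<in>I. v i * (h (x i) - (h m + d * (x i - m)))) = 0" .
  have "0 \<le> v i * (h (x i) - (h m + d * (x i - m)))" if "i \<in> I" for i
    using v(1)[OF that] d[OF x[OF that]] by simp
  with sum0 have "\<forall>i\<in>I. v i * (h (x i) - (h m + d * (x i - m))) = 0"
    using I by (simp only: sum_nonneg_eq_0_iff)
  then have "h (x i) = h m + d * (x i - m)" if "i \<in> I" for i
    using v(1)[OF that] that by force
  with d that show ?thesis by blast
qed

text \<open>The supporting line bounds \<open>h\<close> from below and the chord bounds it from
  above; the two coincide on the interval.\<close>

lemma convex_affine_between:
  fixes h :: "real \<Rightarrow> real"
  assumes h: "convex_on {0..} h" and ab: "0 \<le> a" "a < b"
    and le: "\<And>y. y \<ge> 0 \<Longrightarrow> d * y + e \<le> h y" and eq: "h a = d * a + e" "h b = d * b + e"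
    and y: "a \<le> y" "y \<le> b"
  shows "h y = d * y + e"
proof (rule antisym)
  define t where "t = (y - a) / (b - a)"
  have t: "0 \<le> t" "t \<le> 1" using ab y by (auto simp: t_def)
  have "t * (b - a) = y - a" using ab by (simp add: t_def)
  then have yt: "y = (1 - t) * a + t * b" by (simp add: algebra_simps)
  have "h y \<le> (1 - t) * h a + t * h b"
    using convex_onD[OF h t, of a b] ab unfolding yt by simp
  also have "\<dots> = d * y + e" unfolding eq yt by (simp add: algebra_simps)
  finally show "h y \<le> d * y + e" .
  show "d * y + e \<le> h y" using ab y by (intro le) auto
qed

text \<open>The slopes may a priori vary with the interval. The derivative is locally constant on
  the connected open half-line, hence constant; the end point 0 is reached by continuity.\<close>

lemma locally_affine_imp_affine:
  fixes h :: "real \<Rightarrow> real"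
  assumes cont: "continuous_on {0..} h"
    and loc: "\<And>x. x > 0 \<Longrightarrow> \<exists>a b d e. 0 \<le> a \<and> a < x \<and> x < b \<and> (\<forall>y\<in>{a..b}. h y = d * y + e)"
  obtains d e where "\<And>y. y \<ge> 0 \<Longrightarrow> h y = d * y + e"
proof -
  have der: "\<exists>a b d. 0 \<le> a \<and> a < x \<and> x < b \<and> (\<forall>y\<in>{a<..<b}. DERIV h y :> d)" if x: "x > 0" for x
  proof -
    obtain a b d e where abde: "0 \<le> a" "a < x" "x < b" "\<forall>y\<in>{a..b}. h y = d * y + e"
      using loc[OF x] by blast
    have "DERIV h y :> d" if y: "y \<in> {a<..<b}" for y
    proof -
      have "((\<lambda>y. d * y + e) has_field_derivative d) (at y)"
        by (auto intro!: derivative_eq_intros)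
      then show ?thesis
        by (rule has_field_derivative_transform_within_open[where S = "{a<..<b}"]) (use y abde in auto)
    qed
    with abde show ?thesis by blast
  qed
  have "((deriv h) has_field_derivative 0) (at x within {0<..})" if x: "x \<in> {0<..}" for x
  proof -
    obtain a b d where abd: "0 \<le> a" "a < x" "x < b" "\<forall>y\<in>{a<..<b}. DERIV h y :> d"
      using der x by blast
    have "((\<lambda>_. d) has_field_derivative 0) (at x)" by simp
    then have "((deriv h) has_field_derivative 0) (at x)"
      by (rule has_field_derivative_transform_within_open[where S = "{a<..<b}"])
        (use abd in \<open>auto dest: DERIV_imp_deriv\<close>)
    then show ?thesis by (rule has_field_derivative_at_within)
  qed
  then obtain d where d: "\<And>x. x > 0 \<Longrightarrow> deriv h x = d"
    using has_field_derivative_zero_constant[of "{0<..}" "deriv h"] by auto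
  have hd: "DERIV h x :> d" if "x > 0" for x
    using der[OF that] d[OF that] that by (metis DERIV_imp_deriv greaterThanLessThan_iff)
  have "((\<lambda>x. h x - d * x) has_field_derivative 0) (at x within {0<..})" if "x \<in> {0<..}" for x
    using hd[of x] that by (auto intro!: derivative_eq_intros intro: has_field_derivative_at_within)
  then obtain e where e: "\<And>x. x > 0 \<Longrightarrow> h x - d * x = e"
    using has_field_derivative_zero_constant[of "{0<..}" "\<lambda>x. h x - d * x"] by auto
  have "h y = d * y + e" if "y \<ge> 0" for y
  proof (cases "y = 0")
    case False
    then show ?thesis using e[of y] that by simp
  next
    case True
    have "continuous_on (closure {0<..}) (\<lambda>x. h x - d * x)"
      using cont by (auto intro!: continuous_intros)
    then have "h 0 - d * 0 = e"
      by (rule continuous_constant_on_closure[of _ _ e 0]) (use e in auto)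
    then show ?thesis using True by simp
  qed
  with that show ?thesis by blast
qed

text \<open>Scaling \<open>{q * a..q * b}\<close> by all \<open>q\<close> covers the half-line, so \<open>gamma_p p\<close> would be a Gaussian, and
  then \<open>exp (- \<bar>z\<bar> powr p)\<close> as well by Fourier inversion.\<close>

lemma log_gamma_sqrt_not_affine:
  assumes p: "0 < p" "p < 2" and ab: "0 \<le> a" "a < b"
    and aff: "\<And>q. q > 0 \<Longrightarrow> \<exists>d e. \<forall>y\<in>{q * a..q * b}. log_gamma_sqrt p y = d * y + e"
  shows False
proof -
  obtain d e where de: "\<And>y. y \<ge> 0 \<Longrightarrow> log_gamma_sqrt p y = d * y + e"
  proof (rule locally_affine_imp_affine[OF log_gamma_sqrt_continuous[OF p]])
    fix x :: real assume x: "x > 0"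
    define q where "q = 2 * x / (a + b)"
    have q: "q > 0" using x ab by (simp add: q_def)
    have "q * a < x" "x < q * b" using x ab by (auto simp: q_def field_simps)
    moreover have "0 \<le> q * a" using q ab by simp
    ultimately show "\<exists>a b d e. 0 \<le> a \<and> a < x \<and> x < b \<and> (\<forall>y\<in>{a..b}. log_gamma_sqrt p y = d * y + e)"
      using aff[OF q] by blast
  qed blast
  have "gamma_p p t = exp e * exp (- (- d) * t\<^sup>2)" for t
    by (simp add: gamma_p_eq_exp[OF p] de exp_add[symmetric])
  then show False using gamma_p_not_gaussian[OF p] by blast
qed

text \<open>If the weights are not all equal, some \<open>w k\<close> lies strictly below the mean.
  Equality in Jensen's inequality puts the points over \<open>q * w k\<close> and over the mean on
  one supporting line, so the function is affine between them, for every \<open>q\<close>.\<close>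

lemma log_gamma_sqrt_mean_equality:
  fixes w :: "'n::finite \<Rightarrow> real"
  assumes p: "0 < p" "p < 2" and w: "\<And>i. w i \<ge> 0" "(\<Sum>i\<in>UNIV. w i) = 1"
    and eq: "\<And>q. q > 0 \<Longrightarrow> real CARD('n) * log_gamma_sqrt p (q / real CARD('n)) = (\<Sum>i\<in>UNIV. log_gamma_sqrt p (q * w i))"
  shows "w i = 1 / real CARD('n)"
proof (rule ccontr)
  let ?n = "real CARD('n)"
  assume i: "w i \<noteq> 1 / ?n"
  have "\<exists>k. w k < 1 / ?n"
  proof (rule ccontr)
    assume "\<not> ?thesis"
    then have ge: "\<And>k. 1 / ?n \<le> w k" by (simp add: not_less)
    have "(\<Sum>k\<in>(UNIV::'n set). 1 / ?n) < (\<Sum>k\<in>UNIV. w k)"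
    proof (rule sum_strict_mono_ex1)
      have "1 / ?n < w i" using ge[of i] i by simp
      then show "\<exists>k\<in>UNIV. 1 / ?n < w k" by blast
    qed (use ge in auto)
    then show False using w(2) by simp
  qed
  then obtain k where k: "w k < 1 / ?n" by blast
  show False
  proof (rule log_gamma_sqrt_not_affine[OF p w(1)[of k] k])
    fix q :: real assume q: "q > 0"
    obtain d where d: "\<And>y. y \<ge> 0 \<Longrightarrow> log_gamma_sqrt p (q / ?n) + d * (y - q / ?n) \<le> log_gamma_sqrt p y"
      "\<And>i. i \<in> UNIV \<Longrightarrow> log_gamma_sqrt p (q * w i) = log_gamma_sqrt p (q / ?n) + d * (q * w i - q / ?n)"
    proof (rule convex_jensen_equality[OF log_gamma_sqrt_convex[OF p], where I = "UNIV :: 'n set"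
          and v = "\<lambda>_. 1 / ?n" and x = "\<lambda>i. q * w i" and m = "q / ?n"])
      show "q / ?n = (\<Sum>i\<in>UNIV. 1 / ?n * (q * w i))"
        using w(2) by (simp add: sum_divide_distrib[symmetric] sum_distrib_left[symmetric])
      have "(\<Sum>i\<in>UNIV. 1 / ?n * log_gamma_sqrt p (q * w i)) = 1 / ?n * (\<Sum>i\<in>UNIV. log_gamma_sqrt p (q * w i))"
        by (simp only: sum_distrib_left)
      then show "log_gamma_sqrt p (q / ?n) = (\<Sum>i\<in>UNIV. 1 / ?n * log_gamma_sqrt p (q * w i))"
        by (simp only: eq[OF q, symmetric]) simp
    qed (use q w in auto)
    have "log_gamma_sqrt p y = d * y + (log_gamma_sqrt p (q / ?n) - d * (q / ?n))" if "y \<in> {q * w k..q * (1 / ?n)}" for y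
    proof (rule convex_affine_between[OF log_gamma_sqrt_convex[OF p], of "q * w k" "q * (1 / ?n)"])
      show "q * w k < q * (1 / ?n)" using q k by (rule mult_strict_left_mono[rotated])
    qed (use q w(1)[of k] d that in \<open>auto simp: algebra_simps\<close>)
    then show "\<exists>d e. \<forall>y\<in>{q * w k..q * (1 / ?n)}. log_gamma_sqrt p y = d * y + e" by blast
  qed
qed

text \<open>Jensen's inequality for the two points 0 and \<open>q\<close>, indexed by
  \<open>bool\<close>. Equality makes the supporting line at \<open>q * w\<close> touch at 0, so the
  function is affine on the interval between.\<close>

lemma log_gamma_sqrt_chord_strict:
  assumes p: "0 < p" "p < 2" and w: "0 < w" "w < 1"
    and eq: "\<And>q. q > 0 \<Longrightarrow> log_gamma_sqrt p (q * w) = w * log_gamma_sqrt p q + (1 - w) * log_gamma_sqrt p 0"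
  shows False
proof (rule log_gamma_sqrt_not_affine[OF p order.refl w(1)])
  fix q :: real assume q: "q > 0"
  obtain d where d: "\<And>y. y \<ge> 0 \<Longrightarrow> log_gamma_sqrt p (q * w) + d * (y - q * w) \<le> log_gamma_sqrt p y"
    "\<And>b. b \<in> (UNIV :: bool set) \<Longrightarrow> log_gamma_sqrt p (if b then q else 0)
        = log_gamma_sqrt p (q * w) + d * ((if b then q else 0) - q * w)"
    by (rule convex_jensen_equality[OF log_gamma_sqrt_convex[OF p], where I = "UNIV :: bool set"
          and v = "\<lambda>b. if b then w else 1 - w" and x = "\<lambda>b. if b then q else 0" and m = "q * w"])
      (use q w eq[OF q] in \<open>auto simp: UNIV_bool\<close>)
  have "log_gamma_sqrt p y = d * y + (log_gamma_sqrt p (q * w) - d * (q * w))" if "y \<in> {q * 0..q * w}" for y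
    by (rule convex_affine_between[OF log_gamma_sqrt_convex[OF p], of 0 "q * w"])
      (use q w d(1) d(2)[of False] that in \<open>auto simp: algebra_simps\<close>)
  then show "\<exists>d e. \<forall>y\<in>{q * 0..q * w}. log_gamma_sqrt p y = d * y + e" by blast
qed

text \<open>Equal integrals give equality almost everywhere. The coincidence set is closed by
  continuity, so it contains every point of the open half-line; the equality analysis needs each
  \<open>t\<close>.\<close>

lemma set_integral_half_line_eq:
  fixes f g :: "real \<Rightarrow> real"
  assumes f: "integrable lborel f" "continuous_on UNIV f" and g: "integrable lborel g" "continuous_on UNIV g"
    and le: "\<And>t. f t \<le> g t"
  shows "(LBINT t:{0..}. f t) \<le> (LBINT t:{0..}. g t)"
    and "(LBINT t:{0..}. f t) = (LBINT t:{0..}. g t) \<Longrightarrow> t > 0 \<Longrightarrow> f t = g t"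
proof -
  have i: "integrable lborel (\<lambda>t. indicator {0..} t *\<^sub>R f t)" "integrable lborel (\<lambda>t. indicator {0..} t *\<^sub>R g t)"
    using integrable_mult_indicator[OF _ f(1), of "{0..}"] integrable_mult_indicator[OF _ g(1), of "{0..}"]
    by simp_all
  show "(LBINT t:{0..}. f t) \<le> (LBINT t:{0..}. g t)"
    unfolding set_lebesgue_integral_def using i by (intro integral_mono) (auto simp: le indicator_def)
  assume eq: "(LBINT t:{0..}. f t) = (LBINT t:{0..}. g t)" and t: "t > 0"
  have "(LBINT t. indicator {0..} t *\<^sub>R g t - indicator {0..} t *\<^sub>R f t) = 0"
    using eq i unfolding set_lebesgue_integral_def by (subst Bochner_Integration.integral_diff) auto
  then have "AE t in lborel. indicator {0..} t *\<^sub>R g t - indicator {0..} t *\<^sub>R f t = 0"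
    using i le by (subst (asm) integral_nonneg_eq_0_iff_AE) (auto simp: indicator_def)
  then have "AE t in lebesgue. indicator {0..} t *\<^sub>R g t - indicator {0..} t *\<^sub>R f t = 0"
    by (rule AE_completion)
  then have "AE t \<in> {0<..} in lebesgue. t \<in> {t. f t = g t}"
    by eventually_elim (auto simp: indicator_def)
  moreover have "closed {t. f t = g t}"
    using f(2) g(2) by (rule closed_Collect_eq)
  ultimately show "f t = g t"
    using mem_closed_if_AE_lebesgue_open[of "{0<..}" "{t. f t = g t}" t] t by auto
qed

section \<open>The two bounds and their equality cases\<close>

theorem theorem5:
  fixes p :: real and \<xi> :: "real ^ 'n" and n :: nat
  assumes "n = CARD('n)" and "n > 1"
    and "0 < p" and "p < 2"
    and "\<xi> \<in> sphere 0 1"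
  shows
    "let V = central_section_volume p \<xi>;
         c = p / (pi * (real n - 1) * Gamma ((real n - 1) / p));
         L = c * (LBINT t:{0..}. gamma_p p (t / sqrt (real n)) ^ n);
         U = c * gamma_p p 0 ^ (n - 1) * (LBINT t:{0..}. gamma_p p t)
     in L \<le> V \<and> V \<le> U \<and>
        U = 2 ^ (n - 1) * p * Gamma (1 + 1 / p) ^ (n - 1)
              / ((real n - 1) * Gamma ((real n - 1) / p)) \<and>
        (L = V \<longleftrightarrow> (\<forall>i. \<bar>\<xi> $ i\<bar> = 1 / sqrt (real n))) \<and>
        (V = U \<longleftrightarrow> (\<exists>i. (\<xi> $ i = 1 \<or> \<xi> $ i = - 1) \<and> (\<forall>j. j \<noteq> i \<longrightarrow> \<xi> $ j = 0)))"
proof -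
  note p = assms(3,4)
  have n: "real n > 1" "n \<noteq> 0" using assms(2) by auto
  define c where "c = p / (pi * (real n - 1) * Gamma ((real n - 1) / p))"
  define F where "F = (\<lambda>(x :: real^'n) t. \<Prod>i\<in>UNIV. gamma_p p (t * x $ i))"
  define fl where "fl = (\<lambda>t. gamma_p p (t / sqrt (real n)) ^ n)"
  define fu where "fu = (\<lambda>t. gamma_p p 0 ^ (n - 1) * gamma_p p t)"
  let ?h = "log_gamma_sqrt p"
  have \<Gamma>: "Gamma ((real n - 1) / p) > 0" using n p by (intro Gamma_real_pos) auto
  have c: "c > 0" using n p \<Gamma> by (simp add: c_def)
  have norm_sq: "(\<Sum>i\<in>UNIV. (x $ i)\<^sup>2) = 1" if "norm x = 1" for x :: "real^'n"
    using that by (simp add: norm_vec_def L2_set_def)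
  have \<xi>: "norm \<xi> = 1" using assms(5) by simp
  define w where "w i = (\<xi> $ i)\<^sup>2" for i
  have w: "w i \<ge> 0" "(\<Sum>i\<in>UNIV. w i) = 1" for i
    using norm_sq[OF \<xi>] by (auto simp: w_def)
  have w1: "w i \<le> 1" for i
    using member_le_sum[of i UNIV w] w by simp
  have F_int: "integrable lborel (F x)" if "norm x = 1" for x
    unfolding F_def using assms by (intro central_section_volume_eq(1) p that) simp
  have cont: "continuous_on UNIV (\<lambda>t. gamma_p p (t * a))" for a
    by (intro continuous_on_compose2[OF gamma_p_continuous[OF p(1), of UNIV]] continuous_intros) auto
  have F_cont: "continuous_on UNIV (F x)" for x
    unfolding F_def by (intro continuous_on_prod cont)
  have V: "central_section_volume p \<xi> = c * (LBINT t:{0..}. F \<xi> t)"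
    unfolding F_def c_def using central_section_volume_eq(2)[OF p \<xi>] assms by simp
  \<comment> \<open>The integrand of the lower bound is the one belonging to the diagonal direction,
    so its integrability is an instance of the result for unit vectors.\<close>
  define x0 :: "real^'n" where "x0 = (\<chi> i. 1 / sqrt (real n))"
  have "norm x0 = 1"
    using n by (simp add: x0_def norm_vec_def L2_set_def power_divide assms(1)[symmetric])
  moreover have fl_F: "fl = F x0" by (simp add: fl_def F_def x0_def assms(1))
  ultimately have fl: "integrable lborel fl" "continuous_on UNIV fl" using F_int F_cont by auto
  have fu: "integrable lborel fu" "continuous_on UNIV fu"
    unfolding fu_def using gamma_p_integral(1)[OF p] cont[of 1] by (auto intro!: continuous_intros)
  have F_exp: "F \<xi> t = exp (\<Sum>i\<in>UNIV. ?h (t\<^sup>2 * w i))" for t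
    by (simp add: F_def gamma_p_eq_exp[OF p] exp_sum w_def power_mult_distrib)
  have fl_exp: "fl t = exp (real n * ?h (t\<^sup>2 / real n))" for t
    by (simp add: fl_def gamma_p_eq_exp[OF p] power_divide exp_of_nat_mult[symmetric])
  have fu_exp: "fu t = exp (?h (t\<^sup>2) + (real n - 1) * ?h 0)" for t
    using assms(2) by (simp add: fu_def gamma_p_eq_exp[OF p] exp_of_nat_mult[symmetric] exp_add[symmetric] of_nat_diff add.commute)
  have lower: "real n * ?h (q / real n) \<le> (\<Sum>i\<in>UNIV. ?h (q * w i))" if q: "q \<ge> 0" for q
  proof -
    have "?h (\<Sum>i\<in>UNIV. (1 / real n) *\<^sub>R (q * w i)) \<le> (\<Sum>i\<in>UNIV. 1 / real n * ?h (q * w i))"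
      using q w n by (intro convex_on_sum[OF _ _ log_gamma_sqrt_convex[OF p]]) (auto simp: assms(1))
    also have "(\<Sum>i\<in>UNIV. (1 / real n) *\<^sub>R (q * w i)) = q / real n"
      using w(2) by (simp add: sum_divide_distrib[symmetric] sum_distrib_left[symmetric])
    also have "(\<Sum>i\<in>UNIV. 1 / real n * ?h (q * w i)) = 1 / real n * (\<Sum>i\<in>UNIV. ?h (q * w i))"
      by (simp only: sum_distrib_left)
    finally show ?thesis using n by (simp add: field_simps)
  qed
  have chord: "?h (q * w i) \<le> w i * ?h q + (1 - w i) * ?h 0" if q: "q \<ge> 0" for q i
    using convex_onD[OF log_gamma_sqrt_convex[OF p], of "w i" 0 q] w(1)[of i] w1[of i] q by (simp add: mult.commute add.commute)
  \<comment> \<open>The weights add up to 1 over n indices, so the complementary weights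
    \<open>1 - w i\<close> add up to n - 1, the number of factors \<open>gamma_p p 0\<close> in the
    upper bound.\<close>
  have chord_sum: "(\<Sum>i\<in>UNIV. w i * ?h q + (1 - w i) * ?h 0) = ?h q + (real n - 1) * ?h 0" for q
    using w(2) by (simp add: sum.distrib sum_distrib_right[symmetric] sum_subtractf assms(1))
  have upper: "(\<Sum>i\<in>UNIV. ?h (q * w i)) \<le> ?h q + (real n - 1) * ?h 0" if q: "q \<ge> 0" for q
    unfolding chord_sum[symmetric] by (intro sum_mono chord q)
  have l: "(LBINT t:{0..}. fl t) \<le> (LBINT t:{0..}. F \<xi> t)"
    and l_eq: "(LBINT t:{0..}. fl t) = (LBINT t:{0..}. F \<xi> t) \<Longrightarrow> t > 0 \<Longrightarrow> fl t = F \<xi> t" for t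
    by (rule set_integral_half_line_eq[OF fl F_int[OF \<xi>] F_cont]; simp add: fl_exp F_exp lower)+
  have u: "(LBINT t:{0..}. F \<xi> t) \<le> (LBINT t:{0..}. fu t)"
    and u_eq: "(LBINT t:{0..}. F \<xi> t) = (LBINT t:{0..}. fu t) \<Longrightarrow> t > 0 \<Longrightarrow> F \<xi> t = fu t" for t
    by (rule set_integral_half_line_eq[OF F_int[OF \<xi>] F_cont fu]; simp add: fu_exp F_exp upper)+
  have U: "c * gamma_p p 0 ^ (n - 1) * (LBINT t:{0..}. gamma_p p t) = c * (LBINT t:{0..}. fu t)"
    by (simp add: fu_def)
  have U_val: "c * gamma_p p 0 ^ (n - 1) * (LBINT t:{0..}. gamma_p p t)
     = 2 ^ (n - 1) * p * Gamma (1 + 1 / p) ^ (n - 1) / ((real n - 1) * Gamma ((real n - 1) / p))"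
  proof -
    \<comment> \<open>Half of the integral over the line. It cancels the pi in \<open>c\<close>, and
      \<open>gamma_p p 0 = 2 * Gamma (1 + 1 / p)\<close> supplies the powers of 2.\<close>
    have "(LBINT t:{0..}. gamma_p p t) = pi"
      using integral_even_half_line[OF gamma_p_integral(1)[OF p] gamma_p_minus[OF p(1)]] gamma_p_integral(2)[OF p] by simp
    then show ?thesis by (simp add: c_def gamma_p_0[OF p(1)] power_mult_distrib)
  qed
  have lower_iff: "(LBINT t:{0..}. fl t) = (LBINT t:{0..}. F \<xi> t) \<longleftrightarrow> (\<forall>i. \<bar>\<xi> $ i\<bar> = 1 / sqrt (real n))"
  proof
    assume eq: "(LBINT t:{0..}. fl t) = (LBINT t:{0..}. F \<xi> t)"
    show "\<forall>i. \<bar>\<xi> $ i\<bar> = 1 / sqrt (real n)"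
    proof
      fix i
      have "w i = 1 / real CARD('n)"
      proof (rule log_gamma_sqrt_mean_equality[OF p w])
        fix q :: real assume q: "q > 0"
        show "real CARD('n) * ?h (q / real CARD('n)) = (\<Sum>i\<in>UNIV. ?h (q * w i))"
          using l_eq[OF eq, of "sqrt q"] q by (simp add: fl_exp F_exp assms(1))
      qed
      then have "sqrt (w i) = sqrt (1 / real n)" by (simp add: assms(1))
      then show "\<bar>\<xi> $ i\<bar> = 1 / sqrt (real n)" by (simp add: w_def real_sqrt_divide)
    qed
  next
    assume *: "\<forall>i. \<bar>\<xi> $ i\<bar> = 1 / sqrt (real n)"
    have "w i = 1 / real n" for i
      using *[rule_format, of i] by (simp add: w_def power2_abs[of "\<xi> $ i", symmetric] power_divide del: power2_abs)
    then have "F \<xi> = fl" by (simp add: fun_eq_iff F_exp fl_exp assms(1))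
    then show "(LBINT t:{0..}. fl t) = (LBINT t:{0..}. F \<xi> t)" by simp
  qed
  have upper_iff: "(LBINT t:{0..}. F \<xi> t) = (LBINT t:{0..}. fu t)
      \<longleftrightarrow> (\<exists>i. (\<xi> $ i = 1 \<or> \<xi> $ i = - 1) \<and> (\<forall>j. j \<noteq> i \<longrightarrow> \<xi> $ j = 0))"
  proof
    assume eq: "(LBINT t:{0..}. F \<xi> t) = (LBINT t:{0..}. fu t)"
    \<comment> \<open>Each summand satisfies its own chord inequality, so equality of the sums
      forces equality in every one, and strictness of the chord excludes weights inside (0,
      1).\<close>
    have w01: "w i = 0 \<or> w i = 1" for i
    proof (rule ccontr)
      assume "\<not> ?thesis"
      then have wi: "0 < w i" "w i < 1" using w(1)[of i] w1[of i] by auto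
      show False
      proof (rule log_gamma_sqrt_chord_strict[OF p wi])
        fix q :: real assume q: "q > 0"
        have "(\<Sum>i\<in>UNIV. ?h (q * w i)) = (\<Sum>i\<in>UNIV. w i * ?h q + (1 - w i) * ?h 0)"
          using u_eq[OF eq, of "sqrt q"] q unfolding chord_sum by (simp add: fu_exp F_exp)
        then have "(\<Sum>i\<in>UNIV. w i * ?h q + (1 - w i) * ?h 0 - ?h (q * w i)) = 0"
          by (simp add: sum_subtractf)
        then have "\<forall>i\<in>UNIV. w i * ?h q + (1 - w i) * ?h 0 - ?h (q * w i) = 0"
          using chord[of q] q by (subst (asm) sum_nonneg_eq_0_iff) auto
        then have "w i * ?h q + (1 - w i) * ?h 0 - ?h (q * w i) = 0" by blast
        then show "?h (q * w i) = w i * ?h q + (1 - w i) * ?h 0" by simp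
      qed
    qed
    have "\<exists>i. w i \<noteq> 0"
    proof (rule ccontr)
      assume "\<not> ?thesis"
      then show False using w(2) by simp
    qed
    then obtain i where i: "w i = 1" using w01 by blast
    have "w j = 0" if "j \<noteq> i" for j
    proof -
      have "w i + w j = sum w {i, j}" using that by simp
      also have "\<dots> \<le> sum w UNIV" using w(1) by (intro sum_mono2) auto
      finally show ?thesis using i w(1)[of j] w(2) by simp
    qed
    with i show "\<exists>i. (\<xi> $ i = 1 \<or> \<xi> $ i = - 1) \<and> (\<forall>j. j \<noteq> i \<longrightarrow> \<xi> $ j = 0)"
      by (intro exI[of _ i]) (auto simp: w_def power2_eq_1_iff)
  next
    assume "\<exists>i. (\<xi> $ i = 1 \<or> \<xi> $ i = - 1) \<and> (\<forall>j. j \<noteq> i \<longrightarrow> \<xi> $ j = 0)"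
    then obtain i where i: "\<xi> $ i = 1 \<or> \<xi> $ i = - 1" "\<And>j. j \<noteq> i \<Longrightarrow> \<xi> $ j = 0" by blast
    have "F \<xi> t = fu t" for t
    proof -
      have "F \<xi> t = gamma_p p (t * \<xi> $ i) * (\<Prod>j\<in>UNIV - {i}. gamma_p p (t * \<xi> $ j))"
        unfolding F_def by (intro prod.remove) auto
      also have "(\<Prod>j\<in>UNIV - {i}. gamma_p p (t * \<xi> $ j)) = (\<Prod>j\<in>UNIV - {i}. gamma_p p 0)"
        using i(2) by (intro prod.cong) auto
      also have "\<dots> = gamma_p p 0 ^ (n - 1)" by (simp add: assms(1))
      also have "gamma_p p (t * \<xi> $ i) = gamma_p p t"
        using i(1) by (auto simp: gamma_p_minus[OF p(1)])
      finally show ?thesis by (simp add: fu_def)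
    qed
    then show "(LBINT t:{0..}. F \<xi> t) = (LBINT t:{0..}. fu t)" by simp
  qed
  show ?thesis
    unfolding Let_def c_def[symmetric] fl_def[symmetric] V U
  proof (intro conjI)
    show "c * (LBINT t:{0..}. fl t) \<le> c * (LBINT t:{0..}. F \<xi> t)"
      and "c * (LBINT t:{0..}. F \<xi> t) \<le> c * (LBINT t:{0..}. fu t)"
      using l u c by (simp_all add: mult_left_mono)
    show "c * (LBINT t:{0..}. fu t) = 2 ^ (n - 1) * p * Gamma (1 + 1 / p) ^ (n - 1)
        / ((real n - 1) * Gamma ((real n - 1) / p))"
      by (rule U_val[unfolded U])
    show "c * (LBINT t:{0..}. fl t) = c * (LBINT t:{0..}. F \<xi> t) \<longleftrightarrow> (\<forall>i. \<bar>\<xi> $ i\<bar> = 1 / sqrt (real n))"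
      unfolding lower_iff[symmetric] using c by simp
    show "c * (LBINT t:{0..}. F \<xi> t) = c * (LBINT t:{0..}. fu t)
        \<longleftrightarrow> (\<exists>i. (\<xi> $ i = 1 \<or> \<xi> $ i = - 1) \<and> (\<forall>j. j \<noteq> i \<longrightarrow> \<xi> $ j = 0))"
      unfolding upper_iff[symmetric] using c by simp
  qed
qed

end
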